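(* Let $\mathcal{P}=\{P_1,\ldots,P_s\}$ be a finite set of points in the real projective plane $\mathbb{P}^2(\mathbb{R})$. Then either (a) all points of $\mathcal{P}$ lie on a conic; or (b) there exists a conic $C$ which passes through exactly five of the points of $\mathcal{P}$ and which is determined by these five points, i.e. $C$ is the unique conic passing through these five points.
   Context: A conic in $\mathbb{P}^2(\mathbb{R})$ is a plane algebraic curve of degree two, i.e. it is given by a nonzero homogeneous polynomial of degree $2$ in three variables with real coefficients, up to a nonzero scalar. Conics are allowed to be singular: unions of two lines and double lines are included. A point lies on the conic (the conic passes through the point) if the polynomial vanishes there. The points $P_1,\ldots,P_s$ are distinct. *)

theory Defs
  imports "HOL-Analysis.Analysis" "HOL-Library.Poly_Mapping"
begin

text \<open>Points of the real projective plane: nonzero vectors of \<open>real^3\<close> up to a nonzero scalar.\<close>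

definition proj_rel :: "real^3 \<Rightarrow> real^3 \<Rightarrow> bool" where
  "proj_rel u v \<longleftrightarrow> u \<noteq> 0 \<and> v \<noteq> 0 \<and> (\<exists>c. c \<noteq> 0 \<and> v = c *\<^sub>R u)"

lemma part_equivp_proj_rel: "part_equivp proj_rel"
proof (rule part_equivpI)
  have "proj_rel (axis 1 1) (axis 1 1)"
    by (auto simp: proj_rel_def axis_eq_0_iff intro!: exI[of _ 1])
  then show "\<exists>x. proj_rel x x" ..
  show "symp proj_rel"
  proof (rule sympI)
    fix u v assume "proj_rel u v"
    then obtain c where "u \<noteq> 0" "v \<noteq> 0" "c \<noteq> 0" "v = c *\<^sub>R u" by (auto simp: proj_rel_def)
    then show "proj_rel v u" by (auto simp: proj_rel_def intro!: exI[of _ "inverse c"])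
  qed
  show "transp proj_rel"
  proof (rule transpI)
    fix u v w assume "proj_rel u v" "proj_rel v w"
    then obtain c d where "u \<noteq> 0" "w \<noteq> 0" "c \<noteq> 0" "v = c *\<^sub>R u" "d \<noteq> 0" "w = d *\<^sub>R v"
      by (auto simp: proj_rel_def)
    then show "proj_rel u w" by (auto simp: proj_rel_def intro!: exI[of _ "d * c"])
  qed
qed

quotient_type rp2 = "real^3" / partial: proj_rel
  by (rule part_equivp_proj_rel)

text \<open>
  Polynomials in three variables with real coefficients, indexed by the type \<open>3\<close>:
  a monomial is an exponent vector \<open>3 \<Rightarrow>\<^sub>0 nat\<close>, and a polynomial assigns a
  coefficient to finitely many monomials.
\<close>

type_synonym poly3 = "(3 \<Rightarrow>\<^sub>0 nat) \<Rightarrow>\<^sub>0 real"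

definition poly3_eval :: "poly3 \<Rightarrow> real^3 \<Rightarrow> real" where
  "poly3_eval p v =
    (\<Sum>m\<in>Poly_Mapping.keys p. Poly_Mapping.lookup p m * (\<Prod>i\<in>UNIV. (v $ i) ^ Poly_Mapping.lookup m i))"

definition homogeneous3 :: "nat \<Rightarrow> poly3 \<Rightarrow> bool" where
  "homogeneous3 d p \<longleftrightarrow> (\<forall>m\<in>Poly_Mapping.keys p. (\<Sum>i\<in>UNIV. Poly_Mapping.lookup m i) = d)"

definition poly3_scale :: "real \<Rightarrow> poly3 \<Rightarrow> poly3" where
  "poly3_scale c p = Poly_Mapping.map ((*) c) p"

lemma lookup_poly3_scale [simp]:
  "Poly_Mapping.lookup (poly3_scale c p) m = c * Poly_Mapping.lookup p m"
  by (simp add: poly3_scale_def Poly_Mapping.map.rep_eq when_def)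

lemma keys_poly3_scale: "c \<noteq> 0 \<Longrightarrow> Poly_Mapping.keys (poly3_scale c p) = Poly_Mapping.keys p"
  by (auto simp: in_keys_iff)

lemma poly3_scale_scale: "poly3_scale c (poly3_scale d p) = poly3_scale (c * d) p"
  by (rule poly_mapping_eqI) simp

lemma poly3_scale_one [simp]: "poly3_scale 1 p = p"
  by (rule poly_mapping_eqI) simp

lemma poly3_eval_scale:
  assumes "c \<noteq> 0"
  shows "poly3_eval (poly3_scale c p) v = c * poly3_eval p v"
  by (simp add: poly3_eval_def keys_poly3_scale[OF assms] sum_distrib_left mult.assoc)

lemma poly3_eval_homogeneous:
  assumes "homogeneous3 d p"
  shows "poly3_eval p (c *\<^sub>R v) = c ^ d * poly3_eval p v"
proof -
  have "(\<Prod>i\<in>UNIV. ((c *\<^sub>R v) $ i) ^ Poly_Mapping.lookup m i) =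
      c ^ d * (\<Prod>i\<in>UNIV. (v $ i) ^ Poly_Mapping.lookup m i)"
    if "m \<in> Poly_Mapping.keys p" for m
    using assms that
    by (simp add: homogeneous3_def power_mult_distrib prod.distrib power_sum [symmetric])
  then show ?thesis
    by (simp add: poly3_eval_def sum_distrib_left mult_ac)
qed

text \<open>
  A conic is a nonzero homogeneous polynomial of degree 2 up to a nonzero scalar, not its
  real zero set: distinct conics may have the same real points.
\<close>

definition conic_rel :: "poly3 \<Rightarrow> poly3 \<Rightarrow> bool" where
  "conic_rel p q \<longleftrightarrow>
    p \<noteq> 0 \<and> homogeneous3 2 p \<and> q \<noteq> 0 \<and> homogeneous3 2 q \<and> (\<exists>c. c \<noteq> 0 \<and> q = poly3_scale c p)"

lemma part_equivp_conic_rel: "part_equivp conic_rel"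
proof (rule part_equivpI)
  let ?p = "Poly_Mapping.single (Poly_Mapping.single 1 2) 1 :: poly3"
  have "?p \<noteq> 0"
    by (metis lookup_single_eq lookup_zero zero_neq_one)
  moreover have "homogeneous3 2 ?p"
    by (simp add: homogeneous3_def lookup_single when_def)
  ultimately have "conic_rel ?p ?p"
    by (auto simp: conic_rel_def intro!: exI[of _ 1])
  then show "\<exists>p. conic_rel p p" ..
  show "symp conic_rel"
  proof (rule sympI)
    fix p q assume "conic_rel p q"
    then obtain c where "p \<noteq> 0" "homogeneous3 2 p" "q \<noteq> 0" "homogeneous3 2 q"
      "c \<noteq> 0" "q = poly3_scale c p"
      by (auto simp: conic_rel_def)
    then show "conic_rel q p"
      by (auto simp: conic_rel_def poly3_scale_scale intro!: exI[of _ "inverse c"])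
  qed
  show "transp conic_rel"
  proof (rule transpI)
    fix p q r assume "conic_rel p q" "conic_rel q r"
    then show "conic_rel p r"
      unfolding conic_rel_def by (metis poly3_scale_scale mult_eq_0_iff)
  qed
qed

quotient_type conic = poly3 / partial: conic_rel
  by (rule part_equivp_conic_rel)

lift_definition lies_on :: "rp2 \<Rightarrow> conic \<Rightarrow> bool" is "\<lambda>v p. poly3_eval p v = 0"
  by (auto simp: proj_rel_def conic_rel_def poly3_eval_scale poly3_eval_homogeneous)

end

theory Submission
  imports Defs
begin

text \<open>
  Suppose that \<open>P\<close> lies on no conic. Projecting the conics through three non-collinear points \<open>a\<close>, \<open>b\<close>,
  \<open>c\<close> of \<open>P\<close> by the quadratic Cremona transformation turns them into lines, and a Sylvester--Gallai
  ordinary line of the image is a conic through \<open>a\<close>, \<open>b\<close>, \<open>c\<close> and two further points. The only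
  obstruction is that the points on a side of the triangle are contracted to one point. Melchior's
  inequality yields two lines with at most three points of \<open>P\<close> each which meet in a point \<open>b\<close> of \<open>P\<close>;
  with \<open>a\<close> and \<open>c\<close> on these lines only the side \<open>ac\<close> is harmful, and an ordinary line missing the
  image of that side exists by Kelly's minimal distance argument, unless the images of the remaining
  points are collinear. In the latter case \<open>P\<close> is covered by a conic and the line \<open>ac\<close>; then the
  conic through \<open>b\<close>, one of \<open>a\<close> and \<open>c\<close>, a point on the line but not on the conic, and two points off the
  line is ordinary.
\<close>

section \<open>Ordinary lines in the affine plane\<close>

text \<open>A side carrying at most one point of \<open>P\<close> besides its two vertices
  identifies no two points, so a bound of three points is what makes the sides \<open>ab\<close> and
  \<open>bc\<close> harmless. To find them, each of the k points of a line receives the share (k -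
  3)/k of the term k - 3 in Melchior's sum. A point with at most one line with k \<le> 3 through it
  receives at least -1/2 + 1/4 + 1/4 = 0, so the sum could not be negative if all points were of
  this kind. The three lines through a point that this needs exist because a pair of lines is a
  conic and therefore does not cover \<open>P\<close>. The side \<open>ac\<close> may be rich: all
  its points except \<open>a\<close> and \<open>c\<close> go to one point \<open>p\<close>, and the
  ordinary line must avoid \<open>p\<close> too. With \<open>p\<close> sent to the vertical
  direction at infinity, avoiding \<open>p\<close> means being non-vertical, and this is why Kelly's
  argument is run with vertical distances: it compares non-vertical lines only.\<close>

definition level :: "real \<Rightarrow> real \<times> real \<Rightarrow> real" where
  "level s p = snd p - s * fst p"

text \<open>A line is encoded by the pair of its slope and its intercept, and
  \<open>level s p\<close> is the intercept of the line of slope \<open>s\<close> through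
  \<open>p\<close>. Vertical lines have no code; where abscissas are distinct no connecting line is
  lost.\<close>

definition on_line :: "(real \<times> real) set \<Rightarrow> real \<times> real \<Rightarrow> (real \<times> real) set" where
  "on_line S l = {p \<in> S. level (fst l) p = snd l}"

definition slope :: "real \<times> real \<Rightarrow> real \<times> real \<Rightarrow> real" where
  "slope p q = (snd q - snd p) / (fst q - fst p)"

definition join :: "real \<times> real \<Rightarrow> real \<times> real \<Rightarrow> real \<times> real" where
  "join p q = (slope p q, level (slope p q) p)"

definition lines :: "(real \<times> real) set \<Rightarrow> (real \<times> real) set" where
  "lines S = {join p q |p q. p \<in> S \<and> q \<in> S \<and> fst p \<noteq> fst q}"

lemma slope_commute: "slope p q = slope q p"
  by (metis slope_def minus_diff_eq minus_divide_divide)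

lemma level_eq_iff: "fst p \<noteq> fst q \<Longrightarrow> level s p = level s q \<longleftrightarrow> s = slope p q"
  by (auto simp: level_def slope_def field_simps)

lemma level_slope: "fst p \<noteq> fst q \<Longrightarrow> level (slope p q) q = level (slope p q) p"
  using level_eq_iff by metis

lemma join_commute: "fst p \<noteq> fst q \<Longrightarrow> join p q = join q p"
  by (simp add: join_def slope_commute[of p q] level_slope[of q p])

lemma join_in_lines: "p \<in> S \<Longrightarrow> q \<in> S \<Longrightarrow> fst p \<noteq> fst q \<Longrightarrow> join p q \<in> lines S"
  unfolding lines_def by blast

lemma linesE:
  assumes "l \<in> lines S"
  obtains p q where "p \<in> S" "q \<in> S" "fst p \<noteq> fst q" "l = join p q"
  using assms unfolding lines_def mem_Collect_eq by metis

lemma finite_lines: "finite S \<Longrightarrow> finite (lines S)"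
  by (rule finite_subset[of _ "(\<lambda>(p, q). join p q) ` (Sigma S (\<lambda>_. S))"]) (auto simp: lines_def)

lemma join_unique:
  assumes "fst p \<noteq> fst q" "p \<in> on_line S l" "q \<in> on_line S l"
  shows "l = join p q"
proof -
  have "fst l = slope p q"
    using assms level_eq_iff[of p q "fst l"] by (auto simp: on_line_def)
  with assms(2) show ?thesis by (auto simp: join_def on_line_def prod_eq_iff)
qed

lemma on_line_inj: "p \<in> on_line S l \<Longrightarrow> q \<in> on_line S l \<Longrightarrow> fst p = fst q \<Longrightarrow> p = q"
  by (auto simp: on_line_def level_def prod_eq_iff)

lemma join_on_line:
  assumes "p \<in> S" "q \<in> S" "fst p \<noteq> fst q"
  shows "p \<in> on_line S (join p q)" "q \<in> on_line S (join p q)"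
  using assms level_slope[of p q] by (auto simp: on_line_def join_def)

lemma three_sorted:
  fixes f :: "'a \<Rightarrow> real"
  assumes "inj_on f A" "finite A" "3 \<le> card A"
  obtains a b c where "a \<in> A" "b \<in> A" "c \<in> A" "f a < f b" "f b < f c"
proof -
  have ne: "A \<noteq> {}" using assms by auto
  obtain a where a: "a \<in> A" "\<And>x. x \<in> A \<Longrightarrow> f a \<le> f x"
    using ex_min_if_finite[of "f ` A"] assms(2) ne by (metis arg_min_if_finite(1) arg_min_least)
  obtain c where c: "c \<in> A" "\<And>x. x \<in> A \<Longrightarrow> f x \<le> f c"
    using arg_min_if_finite(1)[OF assms(2) ne, of "\<lambda>x. - f x"]
      arg_min_least[OF assms(2) ne, of _ "\<lambda>x. - f x"] by (metis neg_le_iff_le)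
  have "\<not> A \<subseteq> {a, c}"
  proof
    assume "A \<subseteq> {a, c}"
    then have "card A \<le> card {a, c}" by (intro card_mono) auto
    also have "\<dots> \<le> 2" by (simp add: card_insert_if)
    finally show False using assms(3) by simp
  qed
  then obtain b where b: "b \<in> A" "b \<noteq> a" "b \<noteq> c" by auto
  have "f a \<noteq> f b" "f b \<noteq> f c" using assms(1) a(1) b c(1) by (auto dest: inj_onD)
  then show thesis using that[of a b c] a b c by (meson order_le_less)
qed

text \<open>Kelly's argument with vertical instead of Euclidean distances: the line of a pair at minimal
  distance is ordinary, provided that ties are broken in favour of the larger slope.\<close>

lemma ordinary_nonvertical_line:
  assumes fin: "finite S"
    and nv: "\<exists>u\<in>S. \<exists>v\<in>S. fst u \<noteq> fst v"
    and nc: "\<And>s t. \<exists>p\<in>S. level s p \<noteq> t"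
  shows "\<exists>u\<in>S. \<exists>v\<in>S. fst u \<noteq> fst v \<and> on_line S (join u v) = {u, v}"
proof -
  define Z where "Z = {(l, p) \<in> Sigma (lines S) (\<lambda>_. S). level (fst l) p \<noteq> snd l}"
  define d where "d = (\<lambda>(l, p). \<bar>level (fst l) p - snd l\<bar>)"
  have "Z \<subseteq> Sigma (lines S) (\<lambda>_. S)" by (auto simp: Z_def)
  then have finZ: "finite Z" using fin finite_lines[OF fin] by (auto intro: finite_subset)
  obtain u0 v0 where "u0 \<in> S" "v0 \<in> S" "fst u0 \<noteq> fst v0" using nv by auto
  then have "join u0 v0 \<in> lines S" by (rule join_in_lines)
  moreover obtain p0 where "p0 \<in> S" "level (fst (join u0 v0)) p0 \<noteq> snd (join u0 v0)" using nc by blast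
  ultimately have "(join u0 v0, p0) \<in> Z" by (simp add: Z_def)
  then have neZ: "Z \<noteq> {}" by blast
  define z0 where "z0 = arg_min_on d Z"
  have z0: "z0 \<in> Z" "\<And>z. z \<in> Z \<Longrightarrow> d z0 \<le> d z"
    using arg_min_if_finite(1)[OF finZ neZ] arg_min_least[OF finZ neZ] unfolding z0_def by blast+
  define Y where "Y = {z \<in> Z. d z = d z0}"
  have finY: "finite Y" and neY: "Y \<noteq> {}" using finZ z0(1) unfolding Y_def by (simp, blast)
  define z where "z = arg_min_on (\<lambda>z. - fst (fst z)) Y"
  have zY: "z \<in> Y" and "\<And>y. y \<in> Y \<Longrightarrow> - fst (fst z) \<le> - fst (fst y)"
    using arg_min_if_finite(1)[OF finY neY]
      arg_min_least[OF finY neY, of _ "\<lambda>z. - fst (fst z)"] unfolding z_def by blast+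
  then have zmax: "\<And>y. y \<in> Y \<Longrightarrow> fst (fst y) \<le> fst (fst z)" by (metis neg_le_iff_le)
  have zZ: "z \<in> Z" and zmin: "\<And>y. y \<in> Z \<Longrightarrow> d z \<le> d y" using zY z0 by (auto simp: Y_def)
  have zmax': "fst (fst y) \<le> fst (fst z)" if "y \<in> Z" "d y = d z" for y
    using zmax[of y] that zY by (auto simp: Y_def)
  obtain s t p where z: "z = ((s, t), p)" by (metis prod.exhaust)
  define e where "e = level s p - t"
  have e: "e \<noteq> 0" "d z = \<bar>e\<bar>" and lin: "(s, t) \<in> lines S" and p: "p \<in> S"
    using zZ by (auto simp: Z_def z e_def d_def)
  \<comment> \<open>The line through \<open>p\<close> and a point \<open>c\<close> of the old line,
    paired with another point \<open>b\<close> of the old line, competes for the minimum. Its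
    distance is \<open>\<bar>e\<bar>\<close> times the ratio of the horizontal distances of
    \<open>b\<close> and \<open>p\<close> from \<open>c\<close>.\<close>
  have *: "((slope p c, level (slope p c) p), b) \<in> Z"
      "d ((slope p c, level (slope p c) p), b) = \<bar>e\<bar> * \<bar>fst b - fst c\<bar> / \<bar>fst p - fst c\<bar>"
      "slope p c = s + e / (fst p - fst c)"
    if bc: "b \<in> on_line S (s, t)" "c \<in> on_line S (s, t)" "b \<noteq> c" "fst c \<noteq> fst p" for b c
  proof -
    have x: "fst b \<noteq> fst c" using on_line_inj bc by blast
    have bS: "b \<in> S" "c \<in> S" "snd b = s * fst b + t" "snd c = s * fst c + t"
      using bc by (auto simp: on_line_def level_def)
    have sp: "snd p = s * fst p + t + e" by (simp add: e_def level_def)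
    show sl: "slope p c = s + e / (fst p - fst c)"
      using bc(4) by (auto simp: slope_def sp bS field_simps)
    have "level (slope p c) b - level (slope p c) p = level (slope p c) b - level (slope p c) c"
      using level_slope[of p c] bc(4) by auto
    also have "\<dots> = - e * (fst b - fst c) / (fst p - fst c)"
      using bc(4) by (simp add: sl level_def bS divide_simps) (simp add: algebra_simps)
    finally have lv: "level (slope p c) b - level (slope p c) p = - e * (fst b - fst c) / (fst p - fst c)" .
    then show "d ((slope p c, level (slope p c) p), b) = \<bar>e\<bar> * \<bar>fst b - fst c\<bar> / \<bar>fst p - fst c\<bar>"
      by (simp add: d_def abs_mult)
    have "level (slope p c) b \<noteq> level (slope p c) p" using lv x e bc(4) by auto
    then show "((slope p c, level (slope p c) p), b) \<in> Z"
      using p bS join_in_lines[of p S c] bc(4) by (auto simp: Z_def join_def)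
  qed
  have far: "\<bar>fst p - fst c\<bar> \<le> \<bar>fst b - fst c\<bar>"
    if "b \<in> on_line S (s, t)" "c \<in> on_line S (s, t)" "b \<noteq> c" "fst c \<noteq> fst p" for b c
  proof -
    have "\<bar>e\<bar> \<le> \<bar>e\<bar> * \<bar>fst b - fst c\<bar> / \<bar>fst p - fst c\<bar>"
      using zmin[OF *(1)[OF that]] *(2)[OF that] e by simp
    then have "\<bar>e\<bar> * \<bar>fst p - fst c\<bar> \<le> \<bar>e\<bar> * \<bar>fst b - fst c\<bar>"
      using that(4) by (simp add: field_simps)
    then show ?thesis using e(1) by simp
  qed
  have "card (on_line S (s, t)) < 3"
  proof (rule ccontr)
    assume "\<not> ?thesis"
    moreover have "inj_on fst (on_line S (s, t))" by (auto intro!: inj_onI dest: on_line_inj)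
    moreover have "finite (on_line S (s, t))" using fin by (simp add: on_line_def)
    ultimately obtain x y w where xyw: "x \<in> on_line S (s, t)" "y \<in> on_line S (s, t)" "w \<in> on_line S (s, t)"
      "fst x < fst y" "fst y < fst w"
      using three_sorted[of fst "on_line S (s, t)"] by (metis not_less)
    have "fst p \<le> fst y" if "fst p \<noteq> fst x" using far[of y x] xyw that by fastforce
    moreover have "fst y \<le> fst p" if "fst p \<noteq> fst w" using far[of y w] xyw that by fastforce
    \<comment> \<open>Minimality against both outer points puts \<open>p\<close> vertically above or
      below the middle point \<open>y\<close>. The lines from \<open>p\<close> to the outer points,
      each paired with \<open>y\<close>, then tie with \<open>z\<close>, and one of them has a
      larger slope: the left one if \<open>e > 0\<close>, the right one if
      \<open>e < 0\<close>.\<close>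
    ultimately have py: "fst p = fst y" using xyw by force
    show False
    proof (cases "e > 0")
      case True
      then show False
        using zmax'[OF *(1)[of y x]] *(2)[of y x] *(3)[of y x] xyw py e(2)
        by (cases "y = x") (auto simp: z divide_le_0_iff)
    next
      case False
      then have "e < 0" using e by simp
      then show False
        using zmax'[OF *(1)[of y w]] *(2)[of y w] *(3)[of y w] xyw py e(2)
        by (cases "y = w") (auto simp: z divide_le_0_iff)
    qed
  qed
  moreover obtain u v where uv: "u \<in> S" "v \<in> S" "fst u \<noteq> fst v" "(s, t) = join u v"
    using lin by (auto simp: lines_def)
  ultimately have "card (on_line S (join u v)) \<le> card {u, v}" by (auto simp: card_insert_if)
  moreover have "{u, v} \<subseteq> on_line S (join u v)" using join_on_line[OF uv(1-3)] by simp
  moreover have "finite (on_line S (join u v))" using fin by (simp add: on_line_def)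
  ultimately have "on_line S (join u v) = {u, v}" by (metis card_seteq)
  with uv show ?thesis by blast
qed

section \<open>Melchior's inequality\<close>

text \<open>The order in which a line of slope slightly smaller than \<open>s\<close> meets the points when it is
  swept upwards.\<close>

definition before :: "real \<Rightarrow> real \<times> real \<Rightarrow> real \<times> real \<Rightarrow> bool" where
  "before s p q \<longleftrightarrow> level s p < level s q \<or> level s p = level s q \<and> fst p < fst q"

definition adjacent :: "(real \<times> real) set \<Rightarrow> real \<Rightarrow> real \<times> real \<Rightarrow> real \<times> real \<Rightarrow> bool" where
  "adjacent S s p q \<longleftrightarrow> p \<in> S \<and> q \<in> S \<and> before s p q \<and> \<not> (\<exists>w\<in>S. before s p w \<and> before s w q)"

text \<open>In the rotating sweep, \<open>meets S (l, side) p q\<close> says that the neighbours \<open>p\<close>, \<open>q\<close> are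
  separated when the sweep reaches the slope of the line \<open>l\<close>, which passes through exactly one
  of them.\<close>

definition meets :: "(real \<times> real) set \<Rightarrow> (real \<times> real) \<times> bool \<Rightarrow> real \<times> real \<Rightarrow> real \<times> real \<Rightarrow> bool" where
  "meets S e p q \<longleftrightarrow> adjacent S (fst (fst e)) p q \<and>
     (if snd e then level (fst (fst e)) p = snd (fst e) \<and> snd (fst e) < level (fst (fst e)) q
      else level (fst (fst e)) q = snd (fst e) \<and> level (fst (fst e)) p < snd (fst e))"

lemma before_linear: "p \<noteq> q \<Longrightarrow> before s p q \<or> before s q p"
  by (cases "fst p" "fst q" rule: linorder_cases) (auto simp: before_def level_def prod_eq_iff)

text \<open>The points of \<open>l\<close> form a block of the sweep order. Side \<open>True\<close>
  makes \<open>p\<close> the last point of this block and \<open>q\<close> its successor; side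
  \<open>False\<close> makes \<open>q\<close> the first point and \<open>p\<close> its
  predecessor.\<close>

lemma meets_unique:
  assumes "meets S e p q" "meets S e p' q'"
  shows "p = p' \<and> q = q'"
proof -
  define s where "s = fst (fst e)"
  have adj: "adjacent S s p q" "adjacent S s p' q'"
    using assms by (simp_all add: meets_def s_def)
  show ?thesis
  proof (cases "snd e")
    case True
    then have lev: "level s p = level s p'" "level s p < level s q" "level s p' < level s q'"
      using assms by (auto simp: meets_def s_def)
    have "\<not> before s p p'" "\<not> before s p' p"
      using adj lev by (auto simp: adjacent_def before_def)
    then have "p = p'" using before_linear by blast
    moreover have "\<not> before s q q'" "\<not> before s q' q"
      using adj \<open>p = p'\<close> by (auto simp: adjacent_def)
    then have "q = q'" using before_linear by blast
    ultimately show ?thesis by simp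
  next
    case False
    then have lev: "level s q = level s q'" "level s p < level s q" "level s p' < level s q'"
      using assms by (auto simp: meets_def s_def)
    have "\<not> before s q q'" "\<not> before s q' q"
      using adj lev by (auto simp: adjacent_def before_def)
    then have "q = q'" using before_linear by blast
    moreover have "\<not> before s p p'" "\<not> before s p' p"
      using adj \<open>q = q'\<close> by (auto simp: adjacent_def)
    then have "p = p'" using before_linear by blast
    ultimately show ?thesis by simp
  qed
qed

text \<open>Consecutive points of a line swap when the rotation passes its slope. Another point can
  come between them only after the rotation has passed the slope of its line to \<open>u\<close> (if
  it lies above the line \<open>uv\<close>) or to \<open>v\<close> (if below). At \<open>s'\<close>
  itself ties are still ordered as just before \<open>s'\<close>.\<close>

lemma adjacent_next_slope:
  assumes uv: "u \<in> S" "v \<in> S" "fst u < fst v"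
    and gap: "\<And>w. w \<in> S \<Longrightarrow> level (slope u v) w = level (slope u v) u \<Longrightarrow> fst w \<le> fst u \<or> fst v \<le> fst w"
    and inj: "inj_on fst S"
    and next_slope: "slope u v < s'"
      "\<And>a w. a \<in> {u, v} \<Longrightarrow> w \<in> S - {a} \<Longrightarrow> slope a w \<le> slope u v \<or> s' \<le> slope a w"
  shows "adjacent S s' v u"
proof -
  define s where "s = slope u v"
  \<comment> \<open>The signed vertical offset of \<open>w\<close> from the line \<open>uv\<close>;
    divided by \<open>fst w - fst a\<close> it is the excess of \<open>slope a w\<close> over
    \<open>s\<close>.\<close>
  define h where "h w = level s w - level s u" for w
  have lev: "level s' w = level s u + h w - (s' - s) * fst w" for w
    by (simp add: h_def level_def algebra_simps)
  have huv: "h u = 0" "h v = 0" using level_slope[of u v] uv by (auto simp: h_def s_def)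
  have slp: "slope a w = s + h w / (fst w - fst a)" if "a \<in> {u, v}" "w \<in> S - {a}" for a w
  proof -
    have "fst w \<noteq> fst a" using that uv inj by (auto dest: inj_onD)
    moreover have "snd a = level s u + s * fst a" using huv that by (auto simp: h_def level_def)
    ultimately show ?thesis by (simp add: slope_def h_def level_def field_simps)
  qed
  have pos: "0 < s' - s" using next_slope(1) by (simp add: s_def)
  have no: "\<not> (0 < h w / (fst w - fst a) \<and> h w / (fst w - fst a) < s' - s)"
    if "a \<in> {u, v}" "w \<in> S - {a}" for a w
    using next_slope(2)[OF that] slp[OF that] by (auto simp: s_def)
  have "before s' v u" using pos uv(3) by (simp add: before_def lev huv)
  moreover have False if w: "w \<in> S" "before s' v w" "before s' w u" for w
  proof -
    have wv: "(s' - s) * (fst w - fst v) \<le> h w" "(s' - s) * (fst w - fst v) = h w \<Longrightarrow> fst v < fst w"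
      using w(2) by (auto simp: before_def lev huv algebra_simps)
    have wu: "h w \<le> (s' - s) * (fst w - fst u)" "(s' - s) * (fst w - fst u) = h w \<Longrightarrow> fst w < fst u"
      using w(3) by (auto simp: before_def lev huv algebra_simps)
    have ne: "w \<noteq> u" "w \<noteq> v" using w by (auto simp: before_def)
    consider "h w = 0" | "h w > 0" | "h w < 0" by linarith
    then show False
    proof cases
      case 1
      then have "fst w \<le> fst v" "fst u \<le> fst w"
        using wu wv pos by (auto simp: mult_le_0_iff zero_le_mult_iff)
      moreover have "fst w \<noteq> fst v" "fst w \<noteq> fst u" using wu wv 1 by auto
      moreover have "level s w = level s u" using 1 by (simp add: h_def)
      ultimately show False using gap[of w] w(1) by (auto simp: s_def)
    next
      case 2
      then have "0 < (s' - s) * (fst w - fst u)" using wu by linarith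
      then have x: "0 < fst w - fst u" using pos by (auto simp: zero_less_mult_iff)
      then have "h w < (s' - s) * (fst w - fst u)" using wu by fastforce
      then show False using no[of u w] w(1) ne x 2 by (auto simp: field_simps)
    next
      case 3
      then have "(s' - s) * (fst w - fst v) < 0" using wv by linarith
      then have x: "fst w - fst v < 0" using pos by (auto simp: mult_less_0_iff)
      then have "(s' - s) * (fst w - fst v) < h w" using wv by fastforce
      then show False using no[of v w] w(1) ne x 3 by (auto simp: neg_divide_less_eq zero_less_divide_iff)
    qed
  qed
  ultimately show ?thesis using uv by (auto simp: adjacent_def)
qed

text \<open>The wrap-around case: if no line through \<open>u\<close> or \<open>v\<close> is steeper
  than \<open>uv\<close>, the rotation passes the vertical direction, which reverses the whole
  order, and restarts from the smallest slope. The swapped pair is thereby swapped back.\<close>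

lemma adjacent_first_slope:
  assumes uv: "u \<in> S" "v \<in> S" "fst u < fst v"
    and gap: "\<And>w. w \<in> S \<Longrightarrow> level (slope u v) w = level (slope u v) u \<Longrightarrow> fst w \<le> fst u \<or> fst v \<le> fst w"
    and inj: "inj_on fst S"
    and next_slope: "s' < slope u v"
      "\<And>a w. a \<in> {u, v} \<Longrightarrow> w \<in> S - {a} \<Longrightarrow> s' \<le> slope a w \<and> slope a w \<le> slope u v"
  shows "adjacent S s' u v"
proof -
  define s where "s = slope u v"
  define h where "h w = level s w - level s u" for w
  have lev: "level s' w = level s u + h w - (s' - s) * fst w" for w
    by (simp add: h_def level_def algebra_simps)
  have huv: "h u = 0" "h v = 0" using level_slope[of u v] uv by (auto simp: h_def s_def)
  have slp: "slope a w = s + h w / (fst w - fst a)" "fst w \<noteq> fst a" if "a \<in> {u, v}" "w \<in> S - {a}" for a w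
  proof -
    show "fst w \<noteq> fst a" using that uv inj by (auto dest: inj_onD)
    moreover have "snd a = level s u + s * fst a" using huv that by (auto simp: h_def level_def)
    ultimately show "slope a w = s + h w / (fst w - fst a)" by (simp add: slope_def h_def level_def field_simps)
  qed
  have neg: "s' - s < 0" using next_slope(1) by (simp add: s_def)
  have bd: "s' - s \<le> h w / (fst w - fst a) \<and> h w / (fst w - fst a) \<le> 0"
    if "a \<in> {u, v}" "w \<in> S - {a}" for a w
    using next_slope(2)[OF that] slp[OF that] by (auto simp: s_def)
  have "before s' u v" using neg uv(3) by (simp add: before_def lev huv)
  moreover have False if w: "w \<in> S" "before s' u w" "before s' w v" for w
  proof -
    have wu: "(s' - s) * (fst w - fst u) \<le> h w" "(s' - s) * (fst w - fst u) = h w \<Longrightarrow> fst u < fst w"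
      using w(2) by (auto simp: before_def lev huv algebra_simps)
    have wv: "h w \<le> (s' - s) * (fst w - fst v)" "(s' - s) * (fst w - fst v) = h w \<Longrightarrow> fst w < fst v"
      using w(3) by (auto simp: before_def lev huv algebra_simps)
    have ne: "w \<noteq> u" "w \<noteq> v" using w by (auto simp: before_def)
    consider "h w = 0" | "h w > 0" | "h w < 0" by linarith
    then show False
    proof cases
      case 1
      then have "fst w \<le> fst v" "fst u \<le> fst w"
        using wu wv neg by (auto simp: mult_le_0_iff zero_le_mult_iff)
      moreover have "fst w \<noteq> fst v" "fst w \<noteq> fst u" using wu wv 1 by auto
      moreover have "level s w = level s u" using 1 by (simp add: h_def)
      ultimately show False using gap[of w] w(1) by (auto simp: s_def)
    next
      case 2
      then have x: "fst w - fst u < 0"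
        using bd[of u w] slp(2)[of u w] w(1) ne by (auto simp: divide_le_0_iff)
      then have "h w \<le> (s' - s) * (fst w - fst u)"
        using bd[of u w] w(1) ne by (auto simp: neg_le_divide_eq)
      then show False using wu x by auto
    next
      case 3
      then have x: "fst w - fst v > 0"
        using bd[of v w] slp(2)[of v w] w(1) ne by (auto simp: divide_le_0_iff)
      then have "(s' - s) * (fst w - fst v) \<le> h w"
        using bd[of v w] w(1) ne by (auto simp: le_divide_eq)
      then show False using wv x by auto
    qed
  qed
  ultimately show ?thesis using uv by (auto simp: adjacent_def)
qed

text \<open>The slope sought is the cyclic successor of \<open>slope u v\<close> among the slopes of
  the lines through \<open>u\<close> or \<open>v\<close>.\<close>

lemma meets_exists:
  assumes fin: "finite S" and inj: "inj_on fst S"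
    and nc: "\<And>s t. \<exists>p\<in>S. level s p \<noteq> t"
    and uv: "u \<in> S" "v \<in> S" "fst u < fst v"
    and gap: "\<And>w. w \<in> S \<Longrightarrow> level (slope u v) w = level (slope u v) u \<Longrightarrow> fst w \<le> fst u \<or> fst v \<le> fst w"
  obtains l side where "l \<in> lines S" "meets S (l, side) u v \<or> meets S (l, side) v u"
proof -
  define K where "K = slope u ` (S - {u}) \<union> slope v ` (S - {v})"
  define s where "s = slope u v"
  have finK: "finite K" and sK: "s \<in> K" using fin uv by (auto simp: K_def s_def)
  have inK: "slope a w \<in> K" if "a \<in> {u, v}" "w \<in> S - {a}" for a w using that by (auto simp: K_def)
  obtain s' where s': "s' \<in> K" "s' \<noteq> s" "adjacent S s' v u \<or> adjacent S s' u v"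
  proof (cases "\<exists>k\<in>K. s < k")
    case True
    define s' where "s' = Min {k \<in> K. s < k}"
    have "s' \<in> {k \<in> K. s < k}" unfolding s'_def using True finK by (intro Min_in) auto
    moreover have le: "s' \<le> k" if "k \<in> K" "s < k" for k
      unfolding s'_def using that finK by (intro Min_le) auto
    have "adjacent S s' v u"
    proof (rule adjacent_next_slope[OF uv gap inj])
      show "slope u v < s'" using calculation by (simp add: s_def)
      fix a w assume "a \<in> {u, v}" "w \<in> S - {a}"
      then show "slope a w \<le> slope u v \<or> s' \<le> slope a w"
        using le[of "slope a w"] inK[of a w] unfolding s_def by fastforce
    qed
    ultimately show thesis using that[of s'] by auto
  next
    case False
    define s' where "s' = Min K"
    have s'K: "s' \<in> K" unfolding s'_def using finK sK by (intro Min_in) auto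
    have le: "s' \<le> k" "k \<le> s" if "k \<in> K" for k
      using that finK False by (auto simp: s'_def not_less)
    \<comment> \<open>Otherwise all lines through \<open>u\<close> would have slope
      \<open>s\<close>, and all points would lie on one line.\<close>
    have "s' \<noteq> s"
    proof
      assume "s' = s"
      obtain p where p: "p \<in> S" "level s p \<noteq> level s u" using nc by blast
      then have "p \<noteq> u" by auto
      then have "slope u p \<in> K" "fst u \<noteq> fst p" using p inK[of u p] uv inj by (auto dest: inj_onD)
      then show False using le[of "slope u p"] \<open>s' = s\<close> level_eq_iff[of u p s] p by auto
    qed
    then have lt: "s' < s" using le[OF s'K] by auto
    have "adjacent S s' u v"
    proof (rule adjacent_first_slope[OF uv gap inj])
      show "s' < slope u v" using lt by (simp add: s_def)
      fix a w assume "a \<in> {u, v}" "w \<in> S - {a}"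
      then show "s' \<le> slope a w \<and> slope a w \<le> slope u v"
        using le[of "slope a w"] inK[of a w] by (auto simp: s_def)
    qed
    then show thesis using that[of s'] s'K \<open>s' \<noteq> s\<close> by auto
  qed
  obtain a w where aw: "a \<in> {u, v}" "w \<in> S" "w \<noteq> a" "s' = slope a w"
    using s'(1) unfolding K_def by blast
  have aS: "a \<in> S" using aw uv by auto
  then have "fst a \<noteq> fst w" using aw inj by (auto dest: inj_onD)
  then have l: "join a w \<in> lines S" using join_in_lines aS aw by blast
  \<comment> \<open>The new line contains only one of \<open>u\<close> and \<open>v\<close>; whether
    this is the lower or the upper neighbour decides the side.\<close>
  have "level s' u \<noteq> level s' v" using s'(2) level_eq_iff[of u v s'] uv by (auto simp: s_def)
  then have "meets S (join a w, True) u v \<or> meets S (join a w, True) v u \<or>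
      meets S (join a w, False) u v \<or> meets S (join a w, False) v u"
    using s'(3) aw by (auto simp: meets_def join_def adjacent_def before_def)
  then show thesis using that l by blast
qed

text \<open>Melchior's inequality in the form \<open>\<Sum>\<^sub>l (k\<^sub>l - 3) < 0\<close>. Each pair of consecutive points on a
  line \<open>l\<close> is charged to a side of the first line, in the rotation starting at \<open>l\<close>, which passes
  through one of the two points.\<close>

lemma melchior:
  assumes fin: "finite S" and inj: "inj_on fst S"
    and nc: "\<And>s t. \<exists>p\<in>S. level s p \<noteq> t"
  shows "(\<Sum>l\<in>lines S. int (card (on_line S l)) - 3) < 0"
proof -
  have fino: "finite (on_line S l)" for l using fin by (simp add: on_line_def)
  define top where "top l = (SOME p. p \<in> on_line S l \<and> (\<forall>q\<in>on_line S l. fst q \<le> fst p))" for l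
  have top: "top l \<in> on_line S l \<and> (\<forall>q\<in>on_line S l. fst q \<le> fst (top l))" if "l \<in> lines S" for l
  proof -
    have "on_line S l \<noteq> {}" using that join_on_line by (fastforce simp: lines_def)
    then have "\<exists>p. p \<in> on_line S l \<and> (\<forall>q\<in>on_line S l. fst q \<le> fst p)"
      using arg_min_if_finite(1)[OF fino[of l], of "\<lambda>p. - fst p"]
        arg_min_least[OF fino[of l], of _ "\<lambda>p. - fst p"] by (metis neg_le_iff_le)
    then show ?thesis unfolding top_def by (rule someI_ex)
  qed
  \<comment> \<open>The steepest line through the leftmost point has no point above it, so its upper
    side is never charged. This one free side makes Melchior's inequality strict.\<close>
  obtain r where r: "r \<in> S" "\<And>q. q \<in> S \<Longrightarrow> fst r \<le> fst q"
    using arg_min_if_finite(1)[OF fin, of fst] arg_min_least[OF fin, of _ fst] nc by (metis empty_iff)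
  define K where "K = slope r ` (S - {r})"
  have "S - {r} \<noteq> {}"
  proof
    assume "S - {r} = {}"
    then have "S = {r}" using r by auto
    then show False using nc[of 0 "level 0 r"] by simp
  qed
  then have K: "finite K" "K \<noteq> {}" using fin by (auto simp: K_def)
  then have "Max K \<in> K" by simp
  then obtain q where q: "q \<in> S" "q \<noteq> r" "Max K = slope r q" by (auto simp: K_def)
  define l0 where "l0 = join r q"
  have frq: "fst r \<noteq> fst q" using inj r q by (auto dest: inj_onD)
  then have l0: "l0 \<in> lines S" unfolding l0_def using join_in_lines r q by blast
  have "level (slope r q) p \<le> level (slope r q) r" if p: "p \<in> S" for p
  proof (cases "p = r")
    case False
    then have "fst r < fst p" using r p inj by (metis inj_onD order_le_less)
    moreover have "slope r p \<le> slope r q" using False p K q(3)[symmetric] by (auto simp: K_def)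
    ultimately have "snd p - snd r \<le> slope r q * (fst p - fst r)"
      unfolding slope_def[of r p] by (simp add: divide_le_eq)
    then show ?thesis by (simp add: level_def algebra_simps)
  qed auto
  then have no: "\<not> meets S (l0, True) x y" for x y
    by (auto simp: meets_def l0_def join_def adjacent_def not_less)
  \<comment> \<open>A pair of consecutive points is encoded by its line and its left point, so every
    point of a line except the rightmost one occurs.\<close>
  define D where "D = Sigma (lines S) (\<lambda>l. on_line S l - {top l})"
  define E where "E = Sigma (lines S) (\<lambda>_. UNIV :: bool set) - {(l0, True)}"
  define R where "R d e = (\<exists>v\<in>on_line S (fst d). fst (snd d) < fst v \<and> (meets S e (snd d) v \<or> meets S e v (snd d)))"
    for d e
  have finE: "finite E" using finite_lines[OF fin] by (simp add: E_def)
  have cardE: "int (card E) = 2 * int (card (lines S)) - 1"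
  proof -
    have "card (lines S) > 0" using finite_lines[OF fin] l0 by (auto simp: card_gt_0_iff)
    moreover have "(l0, True) \<in> Sigma (lines S) (\<lambda>_. UNIV :: bool set)" using l0 by simp
    ultimately show ?thesis unfolding E_def
      by (subst card_Diff_singleton) (auto simp: card_SigmaI finite_lines[OF fin])
  qed
  have "card D \<le> card E"
  proof (rule card_le_if_inj_on_rel[OF finE, of D R])
    fix d assume d: "d \<in> D"
    obtain l u where lu: "d = (l, u)" by (cases d)
    have l: "l \<in> lines S" "u \<in> on_line S l" "u \<noteq> top l" using d by (auto simp: D_def lu)
    define A where "A = {w \<in> on_line S l. fst u < fst w}"
    have "fst u \<noteq> fst (top l)" using on_line_inj[OF l(2)] top[OF l(1)] l(3) by blast
    then have "top l \<in> A" using top[OF l(1)] l(2) by (force simp: A_def)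
    then have A: "finite A" "A \<noteq> {}" using fino[of l] unfolding A_def by (simp, blast)
    obtain v where v: "v \<in> A" "\<And>w. w \<in> A \<Longrightarrow> fst v \<le> fst w"
      using arg_min_if_finite(1)[OF A, of fst] arg_min_least[OF A, of _ fst] by metis
    have vl: "v \<in> on_line S l" "fst u < fst v" using v(1) by (auto simp: A_def)
    have lj: "l = join u v" using join_unique[OF _ l(2) vl(1)] vl by simp
    have uvS: "u \<in> S" "v \<in> S" using l vl by (auto simp: on_line_def)
    obtain l' side where e: "l' \<in> lines S" "meets S (l', side) u v \<or> meets S (l', side) v u"
    proof (rule meets_exists[OF fin inj nc uvS vl(2)])
      fix w assume "w \<in> S" "level (slope u v) w = level (slope u v) u"
      then have "w \<in> on_line S l" by (simp add: lj on_line_def join_def)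
      then show "fst w \<le> fst u \<or> fst v \<le> fst w" using v(2)[of w] unfolding A_def by fastforce
    qed
    have "(l', side) \<in> E" using e no[of u v] no[of v u] by (auto simp: E_def)
    moreover have "R d (l', side)" unfolding R_def lu using vl e by auto
    ultimately show "\<exists>e. e \<in> E \<and> R d e" by blast
  next
    fix d d' e assume dd: "d \<in> D" "d' \<in> D" "e \<in> E" "R d e" "R d' e"
    obtain v where v: "v \<in> on_line S (fst d)" "fst (snd d) < fst v" "meets S e (snd d) v \<or> meets S e v (snd d)"
      using dd(4) by (auto simp: R_def)
    obtain v' where v': "v' \<in> on_line S (fst d')" "fst (snd d') < fst v'" "meets S e (snd d') v' \<or> meets S e v' (snd d')"
      using dd(5) by (auto simp: R_def)
    have eq: "snd d = snd d'" "v = v'"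
      using v v' meets_unique[of S e] by (metis order_less_asym)+
    have "snd d \<in> on_line S (fst d)" "snd d' \<in> on_line S (fst d')" using dd by (auto simp: D_def)
    then have "fst d = join (snd d) v" "fst d' = join (snd d) v"
      using join_unique v v' eq by (metis less_irrefl)+
    then show "d = d'" using eq by (simp add: prod_eq_iff)
  qed
  moreover have "int (card D) = (\<Sum>l\<in>lines S. int (card (on_line S l)) - 1)"
  proof -
    have "card D = (\<Sum>l\<in>lines S. card (on_line S l - {top l}))"
      unfolding D_def using finite_lines[OF fin] fino by (intro card_SigmaI) auto
    also have "int \<dots> = (\<Sum>l\<in>lines S. int (card (on_line S l)) - 1)"
    proof (unfold of_nat_sum, rule sum.cong[OF refl])
      fix l assume l: "l \<in> lines S"
      then have "card (on_line S l) > 0" using top[OF l] fino[of l] unfolding card_gt_0_iff by blast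
      then show "int (card (on_line S l - {top l})) = int (card (on_line S l)) - 1"
        using top[OF l] by (simp add: card_Diff_singleton of_nat_diff)
    qed
    finally show ?thesis .
  qed
  ultimately have "(\<Sum>l\<in>lines S. int (card (on_line S l)) - 1) \<le> 2 * int (card (lines S)) - 1"
    using cardE by linarith
  moreover have "(\<Sum>l\<in>lines S. int (card (on_line S l)) - 3)
      = (\<Sum>l\<in>lines S. int (card (on_line S l)) - 1) - 2 * int (card (lines S))"
    by (simp add: sum_subtractf)
  ultimately show ?thesis by linarith
qed

text \<open>By \<open>not_two\<close>, every point lies on at least three connecting lines. If at
  most one of them were poor, every point would receive a nonnegative total weight, against
  Melchior's inequality.\<close>

lemma two_poor_lines:
  assumes fin: "finite S" and ne: "S \<noteq> {}" and inj: "inj_on fst S"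
    and not_two: "\<And>b s s'. b \<in> S \<Longrightarrow> \<exists>w\<in>S. level s w \<noteq> level s b \<and> level s' w \<noteq> level s' b"
  obtains b l l' where "b \<in> on_line S l" "b \<in> on_line S l'" "l \<in> lines S" "l' \<in> lines S" "l \<noteq> l'"
    "card (on_line S l) \<le> 3" "card (on_line S l') \<le> 3"
proof (rule ccontr)
  assume "\<not> thesis"
  note no = this that
  then have uniq: "l = l'"
    if "b \<in> on_line S l" "b \<in> on_line S l'" "l \<in> lines S" "l' \<in> lines S"
      "card (on_line S l) \<le> 3" "card (on_line S l') \<le> 3" for b l l'
    using no that by blast
  have finl: "finite (lines S)" using fin by (rule finite_lines)
  have fino: "finite (on_line S l)" for l using fin by (simp add: on_line_def)
  have two: "2 \<le> card (on_line S l)" if l: "l \<in> lines S" for l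
  proof -
    obtain p q where pq: "p \<in> S" "q \<in> S" "fst p \<noteq> fst q" "l = join p q"
      using l by (blast elim: linesE)
    then have "card {p, q} \<le> card (on_line S l)"
      using join_on_line[OF pq(1-3)] fino by (intro card_mono) auto
    moreover have "p \<noteq> q" using pq by auto
    ultimately show ?thesis by simp
  qed
  define weight where "weight l = (real (card (on_line S l)) - 3) / real (card (on_line S l))" for l
  have nonneg: "0 \<le> (\<Sum>l\<in>{l \<in> lines S. x \<in> on_line S l}. weight l)" if x: "x \<in> S" for x
  proof -
    define L where "L = {l \<in> lines S. x \<in> on_line S l}"
    define P where "P = {l \<in> L. card (on_line S l) \<le> 3}"
    have finL: "finite L" using finl by (simp add: L_def)
    have joinL: "join x w \<in> L" "fst x \<noteq> fst w" if "w \<in> S" "w \<noteq> x" for w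
    proof -
      show "fst x \<noteq> fst w" using inj that x by (auto dest: inj_onD)
      then show "join x w \<in> L" unfolding L_def using join_in_lines join_on_line that x by blast
    qed
    have diff: "join x w \<noteq> join x v" if "w \<in> S" "w \<noteq> x" "level (slope x v) w \<noteq> level (slope x v) x" for v w
      using level_slope[OF joinL(2)[OF that(1,2)]] that(3) by (auto simp: join_def)
    obtain w1 where w1: "w1 \<in> S" "w1 \<noteq> x" using not_two[OF x] by blast
    obtain w2 where w2: "w2 \<in> S" "level (slope x w1) w2 \<noteq> level (slope x w1) x" using not_two[OF x] by blast
    then have w2x: "w2 \<noteq> x" by auto
    obtain w3 where w3: "w3 \<in> S" "level (slope x w1) w3 \<noteq> level (slope x w1) x"
      "level (slope x w2) w3 \<noteq> level (slope x w2) x" using not_two[OF x] by blast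
    then have w3x: "w3 \<noteq> x" by auto
    have "card {join x w1, join x w2, join x w3} = 3"
      using diff[OF w2(1) w2x w2(2)] diff[OF w3(1) w3x w3(2)] diff[OF w3(1) w3x w3(3)]
      by (auto simp: card_insert_if)
    moreover have "{join x w1, join x w2, join x w3} \<subseteq> L" using joinL w1 w2 w2x w3 w3x by auto
    ultimately have L3: "3 \<le> card L" using card_mono[OF finL] by metis
    have "P = {} \<or> (\<exists>l. P = {l})"
    proof (cases "P = {}")
      case False
      then obtain l where l: "l \<in> P" by auto
      have "P \<subseteq> {l}" using uniq[of x _ l] l by (auto simp: P_def L_def)
      then show ?thesis using l by auto
    qed auto
    then have P1: "card P \<le> 1" by auto
    have PL: "P \<subseteq> L" by (auto simp: P_def)
    then have rich: "2 \<le> card (L - P)" using L3 P1 card_Diff_subset[OF finite_subset[OF PL finL] PL] by simp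
    \<comment> \<open>The value of (k - 3)/k at k = 2; the bound 1/4 below is its value at k =
      4.\<close>
    have "- 1 / 2 \<le> weight l" if "l \<in> P" for l
      using two[of l] that by (auto simp: P_def L_def weight_def field_simps)
    then have "- (1 / 2) * real (card P) \<le> (\<Sum>l\<in>P. weight l)"
      using sum_bounded_below[of P "- 1 / 2" weight] by (simp add: mult.commute)
    moreover have "1 / 4 \<le> weight l" if "l \<in> L - P" for l
      using that by (auto simp: P_def weight_def field_simps)
    then have "1 / 4 * real (card (L - P)) \<le> (\<Sum>l\<in>L - P. weight l)"
      using sum_bounded_below[of "L - P" "1 / 4" weight] by (simp add: mult.commute)
    moreover have "(\<Sum>l\<in>L. weight l) = (\<Sum>l\<in>P. weight l) + (\<Sum>l\<in>L - P. weight l)"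
      using sum.subset_diff[OF PL finL, of weight] by simp
    ultimately show ?thesis using P1 rich unfolding L_def by linarith
  qed
  \<comment> \<open>Double counting: the k points of a line collect its weight k times, which
    restores k - 3.\<close>
  have "0 \<le> (\<Sum>x\<in>S. \<Sum>l\<in>{l \<in> lines S. x \<in> on_line S l}. weight l)"
    by (rule sum_nonneg, rule nonneg)
  also have "\<dots> = (\<Sum>l\<in>lines S. \<Sum>x\<in>{x \<in> S. x \<in> on_line S l}. weight l)"
    by (rule sum.swap_restrict[OF fin finl])
  also have "\<dots> = (\<Sum>l\<in>lines S. real (card (on_line S l)) - 3)"
  proof (rule sum.cong[OF refl])
    fix l assume "l \<in> lines S"
    then have "card (on_line S l) > 0" using two by fastforce
    moreover have "{x \<in> S. x \<in> on_line S l} = on_line S l" by (auto simp: on_line_def)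
    ultimately show "(\<Sum>x\<in>{x \<in> S. x \<in> on_line S l}. weight l) = real (card (on_line S l)) - 3"
      by (simp add: weight_def)
  qed
  also have "\<dots> = of_int (\<Sum>l\<in>lines S. int (card (on_line S l)) - 3)" by simp
  finally have "0 \<le> (\<Sum>l\<in>lines S. int (card (on_line S l)) - 3)" by (simp only: of_int_0_le_iff)
  moreover have "\<exists>p\<in>S. level s p \<noteq> t" for s t
    using ne not_two[of _ s s] by (metis ex_in_conv)
  ultimately show False using melchior[OF fin inj] by force
qed

section \<open>Quadratic forms and the Cremona transformation\<close>

text \<open>The determinant of three vectors; \<open>triple a b v = 0\<close> is the equation in
  \<open>v\<close> of the line through \<open>a\<close> and \<open>b\<close>.\<close>

definition triple :: "real^3 \<Rightarrow> real^3 \<Rightarrow> real^3 \<Rightarrow> real" where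
  "triple a b c = cross3 a b \<bullet> c"

lemma inner_real3: "u \<bullet> v = u $ 1 * v $ 1 + u $ 2 * v $ 2 + u $ 3 * v $ 3" for u v :: "real^3"
  by (simp add: inner_vec_def sum_3)

lemma triple_coords:
  "triple a b c = (a$2 * b$3 - a$3 * b$2) * c$1 + (a$3 * b$1 - a$1 * b$3) * c$2 + (a$1 * b$2 - a$2 * b$1) * c$3"
  by (simp add: triple_def inner_real3 cross_components algebra_simps)

lemma triple_rotate: "triple b c a = triple a b c"
  and triple_swap: "triple b a c = - triple a b c"
  by (simp_all add: triple_coords algebra_simps)

lemma triple_refl [simp]: "triple a a b = 0" "triple a b a = 0" "triple b a a = 0"
  by (simp_all add: triple_coords algebra_simps)

lemma triple_zero [simp]: "triple a b 0 = 0"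
  by (simp add: triple_coords)

lemma triple_combination [simp]:
  "triple a b (x *\<^sub>R u + y *\<^sub>R v) = x * triple a b u + y * triple a b v"
  "triple a b (u + v) = triple a b u + triple a b v"
  "triple a b (x *\<^sub>R u) = x * triple a b u"
  by (simp_all add: triple_def inner_add_right)

text \<open>Cramer's rule without division. The three brackets serve as coordinates of
  \<open>v\<close> with respect to the triangle \<open>a\<close>, \<open>b\<close>,
  \<open>c\<close>.\<close>

lemma triple_expansion:
  "triple a b c *\<^sub>R v = triple b c v *\<^sub>R a + triple c a v *\<^sub>R b + triple a b v *\<^sub>R c"
  by (simp add: vec_eq_iff forall_3 triple_coords) (simp add: algebra_simps)

lemma triple_cross: "triple a b (cross3 a b) \<noteq> 0 \<longleftrightarrow> cross3 a b \<noteq> 0"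
  by (simp add: triple_def)

lemma cross3_nonzeroI: "triple u v w \<noteq> 0 \<Longrightarrow> cross3 u v \<noteq> 0"
  by (auto simp: triple_def)

lemma collinear_combination:
  assumes "cross3 a b \<noteq> 0" "triple a b v = 0"
  obtains x y where "v = x *\<^sub>R a + y *\<^sub>R b"
proof -
  define n where "n = cross3 a b"
  have D: "triple a b n \<noteq> 0" using assms(1) by (simp add: n_def triple_cross)
  have "triple a b n *\<^sub>R v = triple b n v *\<^sub>R a + triple n a v *\<^sub>R b"
    using triple_expansion[of a b n v] assms(2) by simp
  then have "v = inverse (triple a b n) *\<^sub>R (triple b n v *\<^sub>R a + triple n a v *\<^sub>R b)"
    using D by (metis real_vector.scale_scale left_inverse scaleR_one)
  then have "v = (inverse (triple a b n) * triple b n v) *\<^sub>R a + (inverse (triple a b n) * triple n a v) *\<^sub>R b"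
    by (simp add: scaleR_add_right)
  then show thesis by (rule that)
qed

lemma parallel_cross3:
  assumes "cross3 s t \<noteq> 0" "w \<bullet> s = 0" "w \<bullet> t = 0"
  obtains k where "w = k *\<^sub>R cross3 s t"
proof -
  define n where "n = cross3 s t"
  have "cross3 w n = 0" using assms Lagrange[of w s t] by (simp add: n_def)
  then have "(n \<bullet> n) *\<^sub>R w = (n \<bullet> w) *\<^sub>R n"
    using Lagrange[of n w n] by (simp add: inner_commute)
  then have "w = inverse (n \<bullet> n) *\<^sub>R ((n \<bullet> w) *\<^sub>R n)"
    using assms(1) by (metis n_def inner_eq_zero_iff real_vector.scale_scale left_inverse scaleR_one)
  then show thesis using that[of "inverse (n \<bullet> n) * (n \<bullet> w)"] by (simp add: n_def)
qed

definition quadform :: "(real^3 \<Rightarrow> real) \<Rightarrow> bool" where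
  "quadform q \<longleftrightarrow> (\<exists>M :: real^3^3. \<forall>v. q v = v \<bullet> (M *v v))"

lemma quadform_product: "quadform (\<lambda>v. (p \<bullet> v) * (r \<bullet> v))"
  unfolding quadform_def
  by (rule exI[of _ "\<chi> i j. p $ i * r $ j"])
    (simp add: inner_real3 matrix_vector_mult_def sum_3 algebra_simps)

lemma quadform_add: "quadform q \<Longrightarrow> quadform r \<Longrightarrow> quadform (\<lambda>v. q v + r v)"
  unfolding quadform_def by (metis inner_add_right matrix_vector_mult_add_rdistrib)

lemma quadform_scale:
  assumes "quadform q"
  shows "quadform (\<lambda>v. k * q v)"
proof -
  obtain M :: "real^3^3" where "\<And>v. q v = v \<bullet> (M *v v)" using assms by (auto simp: quadform_def)
  then have "k * q v = v \<bullet> ((k *\<^sub>R M) *v v)" for v by (simp add: scaleR_matrix_vector_assoc[symmetric])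
  then show ?thesis unfolding quadform_def by blast
qed

definition polar :: "(real^3 \<Rightarrow> real) \<Rightarrow> real^3 \<Rightarrow> real^3 \<Rightarrow> real" where
  "polar q u v = q (u + v) - q u - q v"

lemma quadform_combination:
  assumes "quadform q"
  shows "q (x *\<^sub>R a + y *\<^sub>R b + z *\<^sub>R c) = x\<^sup>2 * q a + y\<^sup>2 * q b + z\<^sup>2 * q c
    + y * z * polar q b c + x * z * polar q a c + x * y * polar q a b"
proof -
  obtain M :: "real^3^3" where M: "\<And>v. q v = v \<bullet> (M *v v)" using assms by (auto simp: quadform_def)
  show ?thesis
    unfolding polar_def M
    by (simp add: inner_add_left inner_add_right matrix_vector_right_distrib scaleR_vector_matrix_assoc
        matrix_vector_mult_scaleR power2_eq_square algebra_simps)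
qed

lemma quadform_scaleR:
  assumes "quadform q"
  shows "q (x *\<^sub>R a) = x\<^sup>2 * q a"
  using quadform_combination[OF assms, of x a 0 0 0 0] by simp

text \<open>The quadratic Cremona transformation based at \<open>a\<close>, \<open>b\<close>, \<open>c\<close>: it turns the conics through
  these three points into lines.\<close>

definition cremona :: "real^3 \<Rightarrow> real^3 \<Rightarrow> real^3 \<Rightarrow> real^3 \<Rightarrow> real^3" where
  "cremona a b c v = vector [triple c a v * triple a b v, triple b c v * triple a b v, triple b c v * triple c a v]"

lemma cremona_nth [simp]:
  "cremona a b c v $ 1 = triple c a v * triple a b v"
  "cremona a b c v $ 2 = triple b c v * triple a b v"
  "cremona a b c v $ 3 = triple b c v * triple c a v"
  by (simp_all add: cremona_def)

lemma cremona_base [simp]: "cremona a b c a = 0" "cremona a b c b = 0" "cremona a b c c = 0"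
  by (simp_all add: vec_eq_iff forall_3)

lemma quadform_cremona: "quadform (\<lambda>v. w \<bullet> cremona a b c v)"
proof -
  have "(\<lambda>v. w \<bullet> cremona a b c v) = (\<lambda>v. w$1 * ((cross3 c a \<bullet> v) * (cross3 a b \<bullet> v))
     + w$2 * ((cross3 b c \<bullet> v) * (cross3 a b \<bullet> v)) + w$3 * ((cross3 b c \<bullet> v) * (cross3 c a \<bullet> v)))"
    by (simp add: inner_real3[of w] triple_def)
  then show ?thesis
    by (simp only: quadform_add quadform_scale quadform_product)
qed

text \<open>In triangle coordinates the zeros at \<open>a\<close>, \<open>b\<close>,
  \<open>c\<close> kill the three squares. The mixed products that remain are the coordinates of the
  Cremona image, with the polar values as coefficients.\<close>

lemma quadform_through_base:
  assumes q: "quadform q" "q a = 0" "q b = 0" "q c = 0" and D: "triple a b c \<noteq> 0"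
  obtains w where "\<And>v. q v = w \<bullet> cremona a b c v"
proof -
  define D where "D = triple a b c"
  define w :: "real^3" where "w = vector [polar q b c / D\<^sup>2, polar q a c / D\<^sup>2, polar q a b / D\<^sup>2]"
  have "q v = w \<bullet> cremona a b c v" for v
  proof -
    have "D\<^sup>2 * q v = q (D *\<^sub>R v)" using quadform_scaleR[OF q(1)] by simp
    also have "\<dots> = q (triple b c v *\<^sub>R a + triple c a v *\<^sub>R b + triple a b v *\<^sub>R c)"
      by (simp only: D_def triple_expansion[of a b c v])
    also have "\<dots> = triple c a v * triple a b v * polar q b c + triple b c v * triple a b v * polar q a c
        + triple b c v * triple c a v * polar q a b"
      by (simp add: quadform_combination[OF q(1)] q)
    also have "\<dots> = D\<^sup>2 * (w \<bullet> cremona a b c v)"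
      using D by (simp add: w_def inner_real3 D_def distrib_left)
    finally show ?thesis using D by (simp add: D_def)
  qed
  then show thesis by (rule that)
qed

text \<open>At the sum of two base points exactly one coordinate of the transformation survives, so
  these three vectors read off the entries of \<open>w\<close>.\<close>

lemma cremona_nonzero:
  assumes "triple a b c \<noteq> 0" "w \<noteq> 0"
  shows "\<exists>v. w \<bullet> cremona a b c v \<noteq> 0"
proof -
  have "w$1 \<noteq> 0 \<or> w$2 \<noteq> 0 \<or> w$3 \<noteq> 0" using assms(2) by (auto simp: vec_eq_iff forall_3)
  moreover have "w \<bullet> cremona a b c (b + c) = w$1 * (triple a b c)\<^sup>2"
    "w \<bullet> cremona a b c (a + c) = w$2 * (triple a b c)\<^sup>2"
    "w \<bullet> cremona a b c (a + b) = w$3 * (triple a b c)\<^sup>2"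
    by (simp_all add: inner_real3[of w] triple_rotate[of b c a] triple_rotate[of a b c, symmetric]
        triple_rotate[of c a b] power2_eq_square)
  ultimately show ?thesis using assms(1) by (metis mult_eq_0_iff power_eq_0_iff)
qed

lemma parallel_to_vertex:
  assumes "triple a b c \<noteq> 0" "triple a b v = 0" "triple b c v = 0"
  shows "cross3 v b = 0"
proof -
  have "triple a b c *\<^sub>R v = triple c a v *\<^sub>R b" using triple_expansion[of a b c v] assms by simp
  then have "triple a b c *\<^sub>R cross3 v b = 0"
    by (metis cross_mult_left cross_refl scaleR_zero_right)
  then show ?thesis using assms(1) by simp
qed

lemma cross3_coordinates:
  "(triple a b c)\<^sup>2 *\<^sub>R cross3 u v =
     (triple b c u * triple c a v - triple c a u * triple b c v) *\<^sub>R cross3 a b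
   + (triple c a u * triple a b v - triple a b u * triple c a v) *\<^sub>R cross3 b c
   + (triple a b u * triple b c v - triple b c u * triple a b v) *\<^sub>R cross3 c a"
proof -
  have "(triple a b c)\<^sup>2 *\<^sub>R cross3 u v = cross3 (triple a b c *\<^sub>R u) (triple a b c *\<^sub>R v)"
    by (simp add: cross_mult_left cross_mult_right power2_eq_square)
  also have "\<dots> = cross3 (triple b c u *\<^sub>R a + triple c a u *\<^sub>R b + triple a b u *\<^sub>R c)
     (triple b c v *\<^sub>R a + triple c a v *\<^sub>R b + triple a b v *\<^sub>R c)"
    by (simp only: triple_expansion[of a b c u] triple_expansion[of a b c v])
  also have "\<dots> = (triple b c u * triple c a v - triple c a u * triple b c v) *\<^sub>R cross3 a b
   + (triple c a u * triple a b v - triple a b u * triple c a v) *\<^sub>R cross3 b c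
   + (triple a b u * triple b c v - triple b c u * triple a b v) *\<^sub>R cross3 c a"
    by (simp add: cross_add_left cross_add_right cross_mult_left cross_mult_right
        cross_skew[of b a] cross_skew[of c b] cross_skew[of a c] algebra_simps)
  finally show ?thesis .
qed

text \<open>Off the sides the transformation is inverting the three coordinates, hence injective. By
  \<open>sides\<close> no side contains both points, so equal images would force both points off all
  sides.\<close>

lemma cremona_independent:
  assumes D: "triple a b c \<noteq> 0" and uv: "cross3 u v \<noteq> 0"
    and vertices: "\<And>x y. x \<in> {u, v} \<Longrightarrow> y \<in> {a, b, c} \<Longrightarrow> cross3 x y \<noteq> 0"
    and sides: "triple a b u \<noteq> 0 \<or> triple a b v \<noteq> 0" "triple b c u \<noteq> 0 \<or> triple b c v \<noteq> 0"
      "triple c a u \<noteq> 0 \<or> triple c a v \<noteq> 0"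
  shows "cross3 (cremona a b c u) (cremona a b c v) \<noteq> 0"
proof
  define X Y Z X' Y' Z' where defs: "X = triple b c u" "Y = triple c a u" "Z = triple a b u"
    "X' = triple b c v" "Y' = triple c a v" "Z' = triple a b v"
  have D': "triple b c a \<noteq> 0" "triple c a b \<noteq> 0" using D triple_rotate by metis+
  assume "cross3 (cremona a b c u) (cremona a b c v) = 0"
  then have eqs: "X * X' * (Z * Y' - Y * Z') = 0" "Y * Y' * (X * Z' - Z * X') = 0" "Z * Z' * (Y * X' - X * Y') = 0"
    by (simp_all add: vec_eq_iff[of _ 0] forall_3 cross_components defs algebra_simps)
  have ne: "Z \<noteq> 0 \<or> X \<noteq> 0" "X \<noteq> 0 \<or> Y \<noteq> 0" "Y \<noteq> 0 \<or> Z \<noteq> 0"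
      "Z' \<noteq> 0 \<or> X' \<noteq> 0" "X' \<noteq> 0 \<or> Y' \<noteq> 0" "Y' \<noteq> 0 \<or> Z' \<noteq> 0"
    using parallel_to_vertex[OF D] parallel_to_vertex[OF D'(1)] parallel_to_vertex[OF D'(2)] vertices
    unfolding defs by blast+
  have s: "Z \<noteq> 0 \<or> Z' \<noteq> 0" "X \<noteq> 0 \<or> X' \<noteq> 0" "Y \<noteq> 0 \<or> Y' \<noteq> 0" using sides by (auto simp: defs)
  \<comment> \<open>If a coordinate vanished at just one of the two points, the equations would kill
    both other coordinates of the second point, making it a vertex.\<close>
  have nz: "x \<noteq> 0 \<and> x' \<noteq> 0"
    if "x \<noteq> 0 \<or> x' \<noteq> 0" "x \<noteq> 0 \<or> y \<noteq> 0" "z \<noteq> 0 \<or> x \<noteq> 0" "x' \<noteq> 0 \<or> y' \<noteq> 0" "z' \<noteq> 0 \<or> x' \<noteq> 0"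
      "y \<noteq> 0 \<or> z \<noteq> 0" "y' \<noteq> 0 \<or> z' \<noteq> 0" "y * y' * (x * z' - z * x') = 0" "z * z' * (y * x' - x * y') = 0"
    for x y z x' y' z' :: real
    using that by (cases "x = 0"; cases "x' = 0") simp_all
  have "X \<noteq> 0 \<and> X' \<noteq> 0" using nz[of X X' Y Z Y' Z'] eqs ne s by blast
  moreover have "Y \<noteq> 0 \<and> Y' \<noteq> 0" using nz[of Y Y' Z X Z' X'] eqs ne s by blast
  moreover have "Z \<noteq> 0 \<and> Z' \<noteq> 0" using nz[of Z Z' X Y X' Y'] eqs ne s by blast
  ultimately have "X * Y' = Y * X' \<and> Y * Z' = Z * Y' \<and> Z * X' = X * Z'" using eqs by auto
  then have "(triple a b c)\<^sup>2 *\<^sub>R cross3 u v = 0"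
    unfolding cross3_coordinates by (simp add: defs[symmetric])
  then show False using D uv by simp
qed

lemma quadform_cremona_line:
  fixes a b c u v defines "q \<equiv> \<lambda>x. cross3 (cremona a b c u) (cremona a b c v) \<bullet> cremona a b c x"
  assumes D: "triple a b c \<noteq> 0" and uv: "cross3 (cremona a b c u) (cremona a b c v) \<noteq> 0"
  shows "quadform q" "\<exists>x. q x \<noteq> 0" "x \<in> {a, b, c, u, v} \<Longrightarrow> q x = 0"
proof -
  show "quadform q" unfolding q_def by (rule quadform_cremona)
  show "\<exists>x. q x \<noteq> 0" unfolding q_def by (rule cremona_nonzero[OF D uv])
  show "q x = 0" if "x \<in> {a, b, c, u, v}" using that by (auto simp: q_def dot_cross_self)
qed

text \<open>Both forms are pulled back from linear forms vanishing at two independent vectors, hence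
  from multiples of their cross product.\<close>

lemma conic_through_five_unique:
  assumes D: "triple a b c \<noteq> 0" and uv: "cross3 (cremona a b c u) (cremona a b c v) \<noteq> 0"
    and q: "quadform q" "\<exists>x. q x \<noteq> 0" "\<And>x. x \<in> {a, b, c, u, v} \<Longrightarrow> q x = 0"
    and r: "quadform r" "\<And>x. x \<in> {a, b, c, u, v} \<Longrightarrow> r x = 0"
  shows "\<exists>k. \<forall>x. r x = k * q x"
proof -
  define n where "n = cross3 (cremona a b c u) (cremona a b c v)"
  have form: "\<exists>k. \<forall>x. d x = k * (n \<bullet> cremona a b c x)"
    if d: "quadform d" "\<And>x. x \<in> {a, b, c, u, v} \<Longrightarrow> d x = 0" for d
  proof -
    obtain w where w: "\<And>x. d x = w \<bullet> cremona a b c x"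
      using quadform_through_base[OF d(1) _ _ _ D] d(2) by auto
    have "w \<bullet> cremona a b c u = 0" "w \<bullet> cremona a b c v = 0"
      using d(2) w by (metis insert_iff)+
    then obtain k where "w = k *\<^sub>R n" unfolding n_def using parallel_cross3[OF uv] by blast
    then show ?thesis using w by auto
  qed
  obtain k where k: "\<And>x. q x = k * (n \<bullet> cremona a b c x)" using form[OF q(1,3)] by blast
  obtain l where l: "\<And>x. r x = l * (n \<bullet> cremona a b c x)" using form[OF r] by blast
  have "k \<noteq> 0" using q(2) k by auto
  then have "r x = l / k * q x" for x by (simp add: k l)
  then show ?thesis by blast
qed

section \<open>Lines in the projective plane\<close>

text \<open>Only pairwise independence is meant: the vectors represent distinct projective
  points.\<close>

definition independent_points :: "(real^3) set \<Rightarrow> bool" where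
  "independent_points V \<longleftrightarrow> finite V \<and> 0 \<notin> V \<and> (\<forall>u\<in>V. \<forall>v\<in>V. u \<noteq> v \<longrightarrow> cross3 u v \<noteq> 0)"

definition chart :: "real^3 \<Rightarrow> real^3 \<Rightarrow> real^3 \<Rightarrow> real^3 \<Rightarrow> real \<times> real" where
  "chart l x y v = ((x \<bullet> v) / (l \<bullet> v), (y \<bullet> v) / (l \<bullet> v))"

text \<open>Finitely many hyperplanes have measure zero and do not fill the space.\<close>

lemma generic_functional:
  assumes "finite W" "0 \<notin> W"
  obtains m :: "real^3" where "\<And>w. w \<in> W \<Longrightarrow> m \<bullet> w \<noteq> 0"
proof -
  have "negligible (\<Union>w\<in>W. {m. w \<bullet> m = 0})"
    using assms by (intro negligible_Union) (auto intro!: negligible_hyperplane)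
  then have "(\<Union>w\<in>W. {m. w \<bullet> m = 0}) \<noteq> (UNIV :: (real^3) set)"
    using non_negligible_UNIV by metis
  then obtain m where "m \<notin> (\<Union>w\<in>W. {m. w \<bullet> m = 0})" by blast
  then show thesis using that[of m] by (auto simp: inner_commute)
qed

text \<open>Multiplicativity of the determinant: the right-hand side expands the determinant of the
  nine inner products.\<close>

lemma triple_functionals:
  "triple l x y * triple u v w =
     (l \<bullet> u) * ((x \<bullet> v) * (y \<bullet> w) - (y \<bullet> v) * (x \<bullet> w))
   - (x \<bullet> u) * ((l \<bullet> v) * (y \<bullet> w) - (y \<bullet> v) * (l \<bullet> w))
   + (y \<bullet> u) * ((l \<bullet> v) * (x \<bullet> w) - (x \<bullet> v) * (l \<bullet> w))"
  unfolding triple_coords inner_real3 by algebra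

lemma chart_collinear:
  assumes "triple l x y \<noteq> 0" "l \<bullet> u \<noteq> 0" "l \<bullet> v \<noteq> 0" "l \<bullet> w \<noteq> 0"
  shows "triple u v w = 0 \<longleftrightarrow>
    (fst (chart l x y v) - fst (chart l x y u)) * (snd (chart l x y w) - snd (chart l x y u)) =
    (snd (chart l x y v) - snd (chart l x y u)) * (fst (chart l x y w) - fst (chart l x y u))"
proof -
  define f where "f = chart l x y"
  have c: "x \<bullet> t = fst (f t) * (l \<bullet> t)" "y \<bullet> t = snd (f t) * (l \<bullet> t)" if "t \<in> {u, v, w}" for t
    using that assms by (auto simp: f_def chart_def)
  have "triple l x y * triple u v w = (l \<bullet> u) * (l \<bullet> v) * (l \<bullet> w) *
      ((fst (f v) - fst (f u)) * (snd (f w) - snd (f u)) - (snd (f v) - snd (f u)) * (fst (f w) - fst (f u)))"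
    unfolding triple_functionals using c[of u] c[of v] c[of w] by (simp add: algebra_simps)
  then show ?thesis using assms by (auto simp: f_def)
qed

lemma chart_inj:
  assumes D: "triple l x y \<noteq> 0" and u: "l \<bullet> u \<noteq> 0" and v: "l \<bullet> v \<noteq> 0"
    and eq: "chart l x y u = chart l x y v"
  shows "cross3 u v = 0"
proof -
  have e: "(l \<bullet> u) * (x \<bullet> v) = (x \<bullet> u) * (l \<bullet> v)" "(l \<bullet> u) * (y \<bullet> v) = (y \<bullet> u) * (l \<bullet> v)"
    using eq u v by (auto simp: chart_def field_simps)
  have "(x \<bullet> u) * (y \<bullet> v) = (y \<bullet> u) * (x \<bullet> v)"
    using e u by algebra
  then have "triple l x y * triple u v w = 0" for w
    unfolding triple_functionals using e by algebra
  then have "triple u v (cross3 u v) = 0" using D by simp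
  then show ?thesis using triple_cross by blast
qed

lemma chart_line:
  assumes D: "triple l x y \<noteq> 0" and V: "\<And>v. v \<in> V \<Longrightarrow> l \<bullet> v \<noteq> 0"
    and uv: "u \<in> V" "v \<in> V" "fst (chart l x y u) \<noteq> fst (chart l x y v)" and w: "w \<in> V"
  shows "chart l x y w \<in> on_line (chart l x y ` V) (join (chart l x y u) (chart l x y v)) \<longleftrightarrow> triple u v w = 0"
  using chart_collinear[OF D V[OF uv(1)] V[OF uv(2)] V[OF w]] w uv(3)
  by (auto simp: on_line_def join_def level_def slope_def divide_simps) (auto simp: algebra_simps)

text \<open>The chart sends \<open>p\<close> to the vertical direction, so the lines missing \<open>p\<close> are the non-vertical ones.\<close>

lemma ordinary_line_missing:
  assumes fin: "finite T" and p: "\<And>t. t \<in> T \<Longrightarrow> cross3 p t \<noteq> 0" and p0: "p \<noteq> 0"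
    and ind: "\<And>s t. s \<in> T \<Longrightarrow> t \<in> T \<Longrightarrow> s \<noteq> t \<Longrightarrow> cross3 s t \<noteq> 0"
    and nc: "\<And>w. w \<noteq> 0 \<Longrightarrow> \<exists>t\<in>T. w \<bullet> t \<noteq> 0"
  obtains s t where "s \<in> T" "t \<in> T" "s \<noteq> t" "triple s t p \<noteq> 0"
    "\<And>r. r \<in> T \<Longrightarrow> triple s t r = 0 \<Longrightarrow> r = s \<or> r = t"
proof -
  obtain m where m: "\<And>w. w \<in> cross3 p ` T \<Longrightarrow> m \<bullet> w \<noteq> 0"
  proof (rule generic_functional)
    show "finite (cross3 p ` T)" using fin by simp
    show "0 \<notin> cross3 p ` T" using p by force
  qed blast
  \<comment> \<open>Since \<open>l \<bullet> t\<close> equals \<open>m \<bullet> cross3 p t\<close>,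
    the line \<open>l\<close> passes through \<open>p\<close> and misses \<open>T\<close>; it
    becomes the line at infinity.\<close>
  define l where "l = cross3 m p"
  \<comment> \<open>\<open>x\<close> vanishes at \<open>p\<close> as well, so the lines through
    \<open>p\<close> are combinations of \<open>l\<close> and \<open>x\<close>, which the chart
    makes vertical.\<close>
  define x where "x = cross3 l p"
  define f where "f = chart l x p"
  have lT: "l \<bullet> t \<noteq> 0" if "t \<in> T" for t
    using m[of "cross3 p t"] that cross_triple[of m p t] by (simp add: l_def inner_commute[of m])
  have T0: "T \<noteq> {}" using nc[of p] p0 by auto
  then have l0: "l \<noteq> 0" using lT by (metis ex_in_conv inner_zero_left)
  have lp: "l \<bullet> p = 0" "x \<bullet> p = 0" by (simp_all add: l_def x_def dot_cross_self)
  have "triple l x p = - (x \<bullet> x)"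
    by (simp add: triple_def x_def inner_real3 cross_components algebra_simps)
  moreover have "x \<bullet> x = (l \<bullet> l) * (p \<bullet> p)"
  proof -
    have "x \<bullet> x = (l \<bullet> l) * (p \<bullet> p) - (l \<bullet> p)\<^sup>2"
      by (simp add: x_def inner_real3 cross_components power2_eq_square algebra_simps)
    then show ?thesis using lp by simp
  qed
  ultimately have D: "triple l x p \<noteq> 0" using l0 p0 by simp
  have comb0: "r *\<^sub>R l + s *\<^sub>R x + t *\<^sub>R p = 0 \<Longrightarrow> r = 0 \<and> s = 0 \<and> t = 0" for r s t
  proof -
    assume "r *\<^sub>R l + s *\<^sub>R x + t *\<^sub>R p = 0"
    then have "triple x p (r *\<^sub>R l + s *\<^sub>R x + t *\<^sub>R p) = 0" "triple p l (r *\<^sub>R l + s *\<^sub>R x + t *\<^sub>R p) = 0"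
      "triple l x (r *\<^sub>R l + s *\<^sub>R x + t *\<^sub>R p) = 0" by simp_all
    moreover have "triple x p l \<noteq> 0" "triple p l x \<noteq> 0" using D triple_rotate by metis+
    ultimately show "r = 0 \<and> s = 0 \<and> t = 0" using D by simp
  qed
  have "\<exists>u\<in>f ` T. \<exists>v\<in>f ` T. fst u \<noteq> fst v \<and> on_line (f ` T) (join u v) = {u, v}"
  proof (rule ordinary_nonvertical_line)
    show "finite (f ` T)" using fin by simp
    show "\<exists>u\<in>f ` T. \<exists>v\<in>f ` T. fst u \<noteq> fst v"
    proof (rule ccontr)
      assume *: "\<not> ?thesis"
      obtain t0 where "t0 \<in> T" using T0 by auto
      then have same: "fst (f t) = fst (f t0)" if "t \<in> T" for t using * that by blast
      have "(1 *\<^sub>R x + (- fst (f t0)) *\<^sub>R l) \<bullet> t = 0" if "t \<in> T" for t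
      proof -
        have "x \<bullet> t = fst (f t) * (l \<bullet> t)" using lT[OF that] by (simp add: f_def chart_def)
        then show ?thesis using same[OF that] by (simp add: inner_diff_left)
      qed
      moreover have "1 *\<^sub>R x + (- fst (f t0)) *\<^sub>R l \<noteq> 0"
        using comb0[of "- fst (f t0)" 1 0] by (auto simp: add.commute)
      ultimately show False using nc by blast
    qed
    fix s c
    have "p - s *\<^sub>R x - c *\<^sub>R l \<noteq> 0"
      using comb0[of "- c" "- s" 1] by (auto simp: algebra_simps)
    then obtain t where t: "t \<in> T" "(p - s *\<^sub>R x - c *\<^sub>R l) \<bullet> t \<noteq> 0" using nc by blast
    then have "level s (f t) \<noteq> c"
      using lT[OF t(1)] by (auto simp: level_def f_def chart_def inner_diff_left divide_simps)
    then show "\<exists>p\<in>f ` T. level s p \<noteq> c" using t by blast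
  qed
  then obtain s t where st: "s \<in> T" "t \<in> T" "fst (f s) \<noteq> fst (f t)"
    "on_line (f ` T) (join (f s) (f t)) = {f s, f t}" by blast
  have inj: "r = s" if "f r = f s" "r \<in> T" "s \<in> T" for r s
    using chart_inj[OF D lT lT] that ind unfolding f_def by blast
  show thesis
  proof (rule that[OF st(1,2)])
    show "s \<noteq> t" using st by auto
    have "triple l x p * triple s t p = (p \<bullet> p) * ((l \<bullet> s) * (x \<bullet> t) - (x \<bullet> s) * (l \<bullet> t))"
      unfolding triple_functionals lp by (simp add: algebra_simps)
    moreover have "(l \<bullet> s) * (x \<bullet> t) - (x \<bullet> s) * (l \<bullet> t) \<noteq> 0"
      using st(3) lT[OF st(1)] lT[OF st(2)] by (auto simp: f_def chart_def divide_simps) (simp add: algebra_simps)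
    ultimately show "triple s t p \<noteq> 0" using p0 by auto
    fix r assume r: "r \<in> T" "triple s t r = 0"
    then have "f r \<in> on_line (f ` T) (join (f s) (f t))"
      using chart_line[OF D, of T s t r] lT st unfolding f_def by blast
    then show "r = s \<or> r = t" using st inj r by blast
  qed
qed

text \<open>\<open>two\<close> says that no pair of lines covers \<open>V\<close>. In a generic
  chart this is the hypothesis of \<open>two_poor_lines\<close>, and the two lines found there
  become the sides \<open>ab\<close> and \<open>bc\<close>.\<close>

lemma good_triangle:
  assumes V: "independent_points V" and V0: "V \<noteq> {}"
    and two: "\<And>l m. l \<noteq> 0 \<Longrightarrow> m \<noteq> 0 \<Longrightarrow> \<exists>v\<in>V. l \<bullet> v \<noteq> 0 \<and> m \<bullet> v \<noteq> 0"
  obtains a b c where "a \<in> V" "b \<in> V" "c \<in> V" "triple a b c \<noteq> 0"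
    "card {v \<in> V. triple a b v = 0} \<le> 3" "card {v \<in> V. triple b c v = 0} \<le> 3"
proof -
  have fin: "finite V" and V00: "0 \<notin> V" and ind: "\<And>u v. u \<in> V \<Longrightarrow> v \<in> V \<Longrightarrow> u \<noteq> v \<Longrightarrow> cross3 u v \<noteq> 0"
    using V by (auto simp: independent_points_def)
  obtain l where l: "\<And>w. w \<in> V \<Longrightarrow> l \<bullet> w \<noteq> 0" using generic_functional[OF fin V00] by blast
  \<comment> \<open>A functional \<open>x\<close> that vanishes on none of these vectors gives the
    points of \<open>V\<close> distinct abscissas
    \<open>(x \<bullet> v) / (l \<bullet> v)\<close>.\<close>
  define W where "W = (\<lambda>(u, v). (l \<bullet> u) *\<^sub>R v - (l \<bullet> v) *\<^sub>R u) ` {(u, v) \<in> Sigma V (\<lambda>_. V). u \<noteq> v}"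
  have "finite W" unfolding W_def using fin by (intro finite_imageI) (auto intro: finite_subset[of _ "Sigma V (\<lambda>_. V)"])
  moreover have "0 \<notin> W"
  proof
    assume "0 \<in> W"
    then obtain u v where uv: "u \<in> V" "v \<in> V" "u \<noteq> v" "(l \<bullet> u) *\<^sub>R v = (l \<bullet> v) *\<^sub>R u" by (auto simp: W_def)
    then have "(l \<bullet> u) *\<^sub>R cross3 u v = 0" by (metis cross_mult_right cross_refl scaleR_zero_right)
    then show False using l uv ind by simp
  qed
  ultimately obtain x where x: "\<And>w. w \<in> W \<Longrightarrow> x \<bullet> w \<noteq> 0" using generic_functional by blast
  have xuv: "(l \<bullet> u) * (x \<bullet> v) \<noteq> (l \<bullet> v) * (x \<bullet> u)" if "u \<in> V" "v \<in> V" "u \<noteq> v" for u v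
  proof -
    have "(l \<bullet> u) *\<^sub>R v - (l \<bullet> v) *\<^sub>R u \<in> W" unfolding W_def using that by force
    then show ?thesis using x by (fastforce simp: inner_diff_right)
  qed
  define y where "y = cross3 l x"
  obtain v0 where v0: "v0 \<in> V" using V0 by blast
  then have v00: "v0 \<noteq> 0" using V00 by auto
  obtain v1 where v1: "v1 \<in> V" "v1 \<noteq> v0"
  proof -
    have "cross3 v0 (axis 1 1) \<noteq> 0 \<or> cross3 v0 (axis 2 1) \<noteq> 0 \<or> cross3 v0 (axis 3 1) \<noteq> 0"
      using cross_basis_nonzero[OF v00] .
    then obtain e where "cross3 v0 e \<noteq> 0" by blast
    then obtain v where "v \<in> V" "cross3 v0 e \<bullet> v \<noteq> 0" using two by blast
    then show thesis using that[of v] dot_cross_self(4)[of v0 e] by (cases "v = v0") auto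
  qed
  have y0: "y \<noteq> 0"
  proof
    assume y: "y = 0"
    have "(l \<bullet> v0) * (x \<bullet> v1) - (l \<bullet> v1) * (x \<bullet> v0) = y \<bullet> cross3 v0 v1"
      by (simp add: y_def inner_real3 cross_components algebra_simps)
    then show False using xuv[OF v0 v1(1)] v1 y by auto
  qed
  then have D: "triple l x y \<noteq> 0" by (simp add: y_def triple_cross)
  define f where "f = chart l x y"
  have fst_f: "fst (f u) \<noteq> fst (f v)" if "u \<in> V" "v \<in> V" "u \<noteq> v" for u v
    using xuv[OF that] l that by (auto simp: f_def chart_def field_simps)
  then have inj: "inj_on fst (f ` V)" "inj_on f V" by (auto simp: inj_on_def) (metis fst_f)
  have line: "f w \<in> on_line (f ` V) (join (f u) (f v)) \<longleftrightarrow> triple u v w = 0"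
    if "u \<in> V" "v \<in> V" "u \<noteq> v" "w \<in> V" for u v w
    using chart_line[OF D l _ _ _ that(4)] that fst_f[OF that(1-3)] unfolding f_def by blast
  have card_line: "card (on_line (f ` V) (join (f u) (f v))) = card {w \<in> V. triple u v w = 0}"
    if "u \<in> V" "v \<in> V" "u \<noteq> v" for u v
  proof -
    have "on_line (f ` V) (join (f u) (f v)) = f ` {w \<in> V. triple u v w = 0}"
      using line[OF that] by (auto simp: on_line_def)
    then show ?thesis using inj(2) by (simp add: card_image inj_on_subset)
  qed
  have not_two: "\<exists>w\<in>f ` V. level s w \<noteq> level s b \<and> level s' w \<noteq> level s' b" for s s' b
  proof -
    \<comment> \<open>The homogeneous equation of the line of slope \<open>r\<close> through
      \<open>b\<close> in the chart.\<close>
    define g where "g r = y - r *\<^sub>R x - level r b *\<^sub>R l" for r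
    have gv: "level r (f v) \<noteq> level r b" if "g r \<bullet> v \<noteq> 0" "v \<in> V" for r v
      using that l[OF that(2)]
      by (auto simp: g_def f_def level_def chart_def inner_diff_left divide_simps)
    have "g r \<noteq> 0" for r
    proof
      assume "g r = 0"
      then have "g r \<bullet> y = 0" by simp
      then have "y \<bullet> y = 0" by (simp add: g_def inner_diff_left y_def dot_cross_self)
      then show False using y0 by simp
    qed
    then obtain v where "v \<in> V" "g s \<bullet> v \<noteq> 0" "g s' \<bullet> v \<noteq> 0" using two by blast
    then show ?thesis using gv by blast
  qed
  obtain B L L' where B: "B \<in> on_line (f ` V) L" "B \<in> on_line (f ` V) L'" "L \<in> lines (f ` V)" "L' \<in> lines (f ` V)"
    "L \<noteq> L'" "card (on_line (f ` V) L) \<le> 3" "card (on_line (f ` V) L') \<le> 3"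
    using two_poor_lines[of "f ` V"] fin V0 inj not_two by blast
  have other: "\<exists>a\<in>V. a \<noteq> b \<and> K = join (f a) (f b)" if K: "K \<in> lines (f ` V)" "f b \<in> on_line (f ` V) K" "b \<in> V" for K b
  proof -
    obtain p q where pq: "p \<in> f ` V" "q \<in> f ` V" "fst p \<noteq> fst q" "K = join p q" using K(1) by (blast elim: linesE)
    then have on: "p \<in> on_line (f ` V) K" "q \<in> on_line (f ` V) K" using join_on_line[OF pq(1-3)] by simp_all
    show ?thesis
    proof (cases "fst p = fst (f b)")
      case True
      then have "K = join q (f b)" using join_unique[OF _ on(2) K(2)] pq by simp
      then show ?thesis using pq True by auto
    next
      case False
      then have "K = join p (f b)" using join_unique[OF _ on(1) K(2)] by simp
      then show ?thesis using pq False by auto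
    qed
  qed
  obtain b where b: "b \<in> V" "B = f b" using B(1) by (auto simp: on_line_def)
  obtain a where a: "a \<in> V" "a \<noteq> b" "L = join (f a) (f b)" using other[OF B(3) _ b(1)] B(1) b(2) by blast
  obtain c where c: "c \<in> V" "c \<noteq> b" "L' = join (f c) (f b)" using other[OF B(4) _ b(1)] B(2) b(2) by blast
  have c': "L' = join (f b) (f c)" using c join_commute fst_f b by metis
  show thesis
  proof (rule that[OF a(1) b(1) c(1)])
    show "triple a b c \<noteq> 0"
    proof
      assume "triple a b c = 0"
      then have "f c \<in> on_line (f ` V) L" using line[OF a(1) b(1) a(2) c(1)] a by blast
      then have "L = join (f c) (f b)" using join_unique[of "f c" "f b"] B(1) b(2) fst_f[OF c(1) b(1) c(2)] by blast
      then show False using B(5) c by simp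
    qed
    show "card {v \<in> V. triple a b v = 0} \<le> 3" using card_line[OF a(1) b(1) a(2)] B(6) a by simp
    show "card {v \<in> V. triple b c v = 0} \<le> 3" using card_line[OF b(1) c(1)] c(2) B(7) c' by auto
  qed
qed

section \<open>Ordinary conics\<close>

lemma on_common_line:
  assumes "cross3 x y \<noteq> 0" "triple x y a = 0" "triple x y d = 0"
  shows "triple a x d = 0" "triple a y d = 0"
proof -
  obtain r s where a: "a = r *\<^sub>R x + s *\<^sub>R y" using collinear_combination assms by metis
  obtain r' s' where d: "d = r' *\<^sub>R x + s' *\<^sub>R y" using collinear_combination assms by metis
  show "triple a x d = 0" "triple a y d = 0" unfolding a d by (simp_all add: triple_coords algebra_simps)
qed

lemma eq_0_on_basis:
  assumes D: "triple x y z \<noteq> 0" and m: "m \<bullet> x = 0" "m \<bullet> y = 0" "m \<bullet> z = 0"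
  shows "m = 0"
proof -
  have "m \<bullet> (triple x y z *\<^sub>R m) = 0"
    unfolding triple_expansion[of x y z m] by (simp add: inner_add_right m)
  then show ?thesis using D by simp
qed

text \<open>Uniqueness is stated linearly: the forms vanishing at the five points are the multiples
  of \<open>q\<close>, with \<open>k = 0\<close> for the zero form.\<close>

definition ordinary_conic :: "(real^3) set \<Rightarrow> (real^3 \<Rightarrow> real) \<Rightarrow> bool" where
  "ordinary_conic V q \<longleftrightarrow> quadform q \<and> (\<exists>x. q x \<noteq> 0) \<and> card {v \<in> V. q v = 0} = 5 \<and>
    (\<forall>d. quadform d \<longrightarrow> (\<forall>v\<in>V. q v = 0 \<longrightarrow> d v = 0) \<longrightarrow> (\<exists>k. \<forall>x. d x = k * q x))"

lemma ordinary_conicI: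
  assumes D: "triple a b c \<noteq> 0" and uv: "cross3 (cremona a b c u) (cremona a b c v) \<noteq> 0"
    and V: "{a, b, c, u, v} \<subseteq> V" "card {a, b, c, u, v} = 5"
    and only: "\<And>x. x \<in> V \<Longrightarrow> cross3 (cremona a b c u) (cremona a b c v) \<bullet> cremona a b c x = 0
      \<Longrightarrow> x \<in> {a, b, c, u, v}"
  shows "\<exists>q. ordinary_conic V q"
proof -
  define q where "q x = cross3 (cremona a b c u) (cremona a b c v) \<bullet> cremona a b c x" for x
  have q: "quadform q" "\<exists>x. q x \<noteq> 0" "\<And>x. x \<in> {a, b, c, u, v} \<Longrightarrow> q x = 0"
    unfolding q_def using quadform_cremona_line[OF D uv] by blast+
  have five: "{x \<in> V. q x = 0} = {a, b, c, u, v}"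
    using only q(3) V(1) unfolding q_def by blast
  have "\<exists>k. \<forall>x. d x = k * q x" if "quadform d" "\<forall>v\<in>V. q v = 0 \<longrightarrow> d v = 0" for d
    using five that(2) by (intro conic_through_five_unique[OF D uv q that(1)]) blast+
  then have "ordinary_conic V q"
    unfolding ordinary_conic_def using q(1,2) five V(2) by simp
  then show ?thesis by blast
qed

text \<open>Here all points off the line \<open>n \<bullet> x = 0\<close> lie on the conic \<open>q = 0\<close>. The conic through \<open>a\<close>, \<open>b\<close>,
  \<open>d\<close>, \<open>f\<close>, \<open>g\<close> meets the line only in \<open>a\<close>, \<open>d\<close>, and a further point off the line would force it
  to coincide with \<open>q\<close>.\<close>

lemma ordinary_conic_near_line:
  assumes V: "independent_points V" and mem: "a \<in> V" "b \<in> V" "d \<in> V" "f \<in> V" "g \<in> V"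
    and n: "n \<bullet> a = 0" "n \<bullet> d = 0" "n \<bullet> b \<noteq> 0" "n \<bullet> f \<noteq> 0" "n \<bullet> g \<noteq> 0"
    and q: "quadform q" "q a = 0" "q d \<noteq> 0" "\<And>v. v \<in> V \<Longrightarrow> n \<bullet> v \<noteq> 0 \<Longrightarrow> q v = 0"
    and D: "triple b f g \<noteq> 0" and afg: "triple a f g \<noteq> 0"
    and poor: "\<And>u v. u \<in> V - {a, b} \<Longrightarrow> v \<in> V - {a, b} \<Longrightarrow> u \<noteq> v \<Longrightarrow> triple a b u \<noteq> 0 \<or> triple a b v \<noteq> 0"
  shows "\<exists>q. ordinary_conic V q"
proof -
  have ind: "\<And>u v. u \<in> V \<Longrightarrow> v \<in> V \<Longrightarrow> u \<noteq> v \<Longrightarrow> cross3 u v \<noteq> 0"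
    using V by (auto simp: independent_points_def)
  have ad: "a \<noteq> d" using q by auto
  have adx: "cross3 a d \<noteq> 0" using ind[OF mem(1,3) ad] .
  obtain k where k: "n = k *\<^sub>R cross3 a d" using parallel_cross3[OF adx n(1,2)] by blast
  have nk: "n \<bullet> x = k * triple a d x" for x by (simp add: k triple_def)
  have k0: "k \<noteq> 0" using n(3) nk by auto
  have ne: "a \<noteq> b" "a \<noteq> f" "a \<noteq> g" "d \<noteq> b" "d \<noteq> f" "d \<noteq> g" using n by auto
  have ne': "b \<noteq> f" "b \<noteq> g" "f \<noteq> g" using D by auto
  \<comment> \<open>A line through a point off the line \<open>ad\<close> meets it only
    once.\<close>
  have off: "\<not> (triple x y a = 0 \<and> triple x y d = 0)" if "n \<bullet> x \<noteq> 0" "cross3 x y \<noteq> 0" for x y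
    using on_common_line[OF that(2), of a d] that(1) nk triple_rotate triple_swap
    by (metis mult_eq_0_iff neg_equal_0_iff_equal)
  have indep: "cross3 (cremona b f g a) (cremona b f g d) \<noteq> 0"
  proof (rule cremona_independent[OF D adx])
    show "cross3 x y \<noteq> 0" if "x \<in> {a, d}" "y \<in> {b, f, g}" for x y using that ind mem ne by auto
    show "triple b f a \<noteq> 0 \<or> triple b f d \<noteq> 0" using off[of b f] ind[OF mem(2,4)] ne' n by auto
    show "triple f g a \<noteq> 0 \<or> triple f g d \<noteq> 0" using off[of f g] ind[OF mem(4,5)] ne' n by auto
    show "triple g b a \<noteq> 0 \<or> triple g b d \<noteq> 0" using off[of g b] ind[OF mem(5,2)] ne' n by auto
  qed
  define r where "r x = cross3 (cremona b f g a) (cremona b f g d) \<bullet> cremona b f g x" for x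
  have r: "quadform r" "\<exists>x. r x \<noteq> 0" "\<And>x. x \<in> {b, f, g, a, d} \<Longrightarrow> r x = 0"
    unfolding r_def using quadform_cremona_line[OF D indep] by blast+
  show ?thesis
  proof (rule ordinary_conicI[OF D indep])
    show "{b, f, g, a, d} \<subseteq> V" using mem by auto
    show "card {b, f, g, a, d} = 5" using ne ne' ad by auto
    fix x assume x: "x \<in> V" "cross3 (cremona b f g a) (cremona b f g d) \<bullet> cremona b f g x = 0"
    then have rx: "r x = 0" by (simp add: r_def)
    show "x \<in> {b, f, g, a, d}"
    proof (rule ccontr)
      assume nx: "x \<notin> {b, f, g, a, d}"
      show False
      proof (cases "n \<bullet> x = 0")
        case True
        then have "triple a d x = 0" using nk k0 by simp
        then obtain s t where st: "x = s *\<^sub>R a + t *\<^sub>R d" using collinear_combination[OF adx] by blast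
        have "s \<noteq> 0"
        proof
          assume "s = 0"
          then have "cross3 x d = 0" using st by (simp add: cross_mult_left)
          then show False using ind[OF x(1) mem(3)] nx by auto
        qed
        moreover have "t \<noteq> 0"
        proof
          assume "t = 0"
          then have "cross3 x a = 0" using st by (simp add: cross_mult_left)
          then show False using ind[OF x(1) mem(1)] nx by auto
        qed
        moreover have ra: "r a = 0" "r d = 0" "r b = 0" using r(3) by auto
        have "r x = s * t * polar r a d"
          using quadform_combination[OF r(1), of s a t d 0 0] st ra by simp
        ultimately have pol: "polar r a d = 0" using rx by simp
        have D': "triple a d b \<noteq> 0" using nk n(3) by auto
        \<comment> \<open>The conic \<open>r\<close> meets the line in \<open>a\<close>,
          \<open>d\<close> and \<open>x\<close>, hence contains it: \<open>w $ 3\<close>, read off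
          at \<open>a + d\<close>, belongs to the only term not divisible by
          \<open>triple a d v\<close>. The cofactor \<open>m\<close> vanishes at the non-collinear
          points \<open>b\<close>, \<open>f\<close>, \<open>g\<close>.\<close>
        obtain w where w: "\<And>v. r v = w \<bullet> cremona a d b v"
          using quadform_through_base[OF r(1) ra D'] by blast
        have "r (a + d) = 0" using pol ra by (simp add: polar_def)
        moreover have "r (a + d) = w $ 3 * (triple a d b)\<^sup>2"
          by (simp add: w inner_real3[of w] triple_rotate[of a d b] triple_rotate[of d b a] power2_eq_square)
        ultimately have w3: "w $ 3 = 0" using D' by simp
        define m where "m = (w $ 1) *\<^sub>R cross3 b a + (w $ 2) *\<^sub>R cross3 d b"
        have rm: "r v = triple a d v * (m \<bullet> v)" for v
          by (simp add: w inner_real3[of w] w3 m_def inner_add_left triple_def algebra_simps)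
        have "m \<bullet> f = 0" "m \<bullet> g = 0"
          using rm[of f] rm[of g] r(3) n nk by auto
        moreover have "m \<bullet> b = 0" by (simp add: m_def inner_add_left dot_cross_self)
        ultimately have "m = 0" using eq_0_on_basis[OF D] by blast
        then show False using rm r(2) by simp
      next
        case False
        \<comment> \<open>Both \<open>q\<close> and \<open>r\<close> vanish at \<open>b\<close>,
          \<open>f\<close>, \<open>g\<close>, \<open>a\<close>, \<open>x\<close>, so
          \<open>q\<close> would be a multiple of \<open>r\<close> and vanish at \<open>d\<close>.
          The points \<open>a\<close> and \<open>x\<close> share no side of \<open>bfg\<close>:
          \<open>a\<close> is not on \<open>fg\<close>, and on \<open>bf\<close> or
          \<open>gb\<close> they would make \<open>ab\<close> too rich.\<close>
        have indep': "cross3 (cremona b f g a) (cremona b f g x) \<noteq> 0"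
        proof (rule cremona_independent[OF D])
          show "cross3 a x \<noteq> 0" using ind[OF mem(1) x(1)] nx by auto
          show "cross3 y z \<noteq> 0" if "y \<in> {a, x}" "z \<in> {b, f, g}" for y z
            using that ind mem ne x nx by auto
          show "triple f g a \<noteq> 0 \<or> triple f g x \<noteq> 0" using afg triple_rotate by metis
          show "triple b f a \<noteq> 0 \<or> triple b f x \<noteq> 0"
          proof (rule ccontr)
            assume "\<not> ?thesis"
            then have "triple a b f = 0" "triple a b x = 0"
              using on_common_line(1)[OF ind[OF mem(2,4) ne'(1)], of a x] triple_rotate by metis+
            then show False using poor[of f x] mem x nx ne ne' by auto
          qed
          show "triple g b a \<noteq> 0 \<or> triple g b x \<noteq> 0"
          proof (rule ccontr)
            assume *: "\<not> ?thesis"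
            then have "triple a b x = 0"
              using on_common_line(2)[OF ind[OF mem(5,2)], of a x] ne' by auto
            moreover have "triple a b g = 0"
              using * triple_rotate triple_swap by (metis neg_equal_0_iff_equal)
            ultimately show False using poor[of g x] mem x nx ne ne' by auto
          qed
        qed
        have "\<exists>k. \<forall>x. q x = k * r x"
        proof (rule conic_through_five_unique[OF D indep' r(1,2) _ q(1)])
          show "r y = 0" if "y \<in> {b, f, g, a, x}" for y using that r(3) rx by auto
          show "q y = 0" if "y \<in> {b, f, g, a, x}" for y using that q(2,4) mem n x False by auto
        qed
        then show False using q(3) r(3)[of d] by auto
      qed
    qed
  qed
qed

lemma poor_line:
  assumes "finite V" "card {v \<in> V. triple a b v = 0} \<le> 3" "a \<in> V" "b \<in> V" "a \<noteq> b"
    and uv: "u \<in> V - {a, b}" "v \<in> V - {a, b}" "u \<noteq> v"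
  shows "triple a b u \<noteq> 0 \<or> triple a b v \<noteq> 0"
proof (rule ccontr)
  assume "\<not> ?thesis"
  then have "card {a, b, u, v} \<le> card {v \<in> V. triple a b v = 0}"
    using assms by (intro card_mono) auto
  moreover have "card {a, b, u, v} = 4" using assms by auto
  ultimately show False using assms(2) by simp
qed

lemma ordinary_conic_exists:
  assumes V: "independent_points V"
    and no_conic: "\<nexists>q. quadform q \<and> (\<exists>x. q x \<noteq> 0) \<and> (\<forall>v\<in>V. q v = 0)"
  shows "\<exists>q. ordinary_conic V q"
proof -
  have fin: "finite V" and ind: "\<And>u v. u \<in> V \<Longrightarrow> v \<in> V \<Longrightarrow> u \<noteq> v \<Longrightarrow> cross3 u v \<noteq> 0"
    using V by (auto simp: independent_points_def)
  \<comment> \<open>A pair of lines is a conic, the product of its two equations.\<close>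
  have two: "\<exists>v\<in>V. l \<bullet> v \<noteq> 0 \<and> m \<bullet> v \<noteq> 0" if lm: "l \<noteq> 0" "m \<noteq> 0" for l m :: "real^3"
  proof -
    obtain x where "\<And>w. w \<in> {l, m} \<Longrightarrow> x \<bullet> w \<noteq> 0" using generic_functional[of "{l, m}"] lm by auto
    then have "(l \<bullet> x) * (m \<bullet> x) \<noteq> 0" by (simp add: inner_commute)
    then have "\<exists>v\<in>V. (l \<bullet> v) * (m \<bullet> v) \<noteq> 0" using no_conic quadform_product[of l m] by blast
    then show ?thesis by auto
  qed
  have "V \<noteq> {}" using two[of "axis 1 1" "axis 1 1"] by (auto simp: axis_eq_0_iff)
  then obtain a b c where abc: "a \<in> V" "b \<in> V" "c \<in> V" and D: "triple a b c \<noteq> 0"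
    and card3: "card {v \<in> V. triple a b v = 0} \<le> 3" "card {v \<in> V. triple b c v = 0} \<le> 3"
    using good_triangle[OF V _ two] by blast
  have ne: "a \<noteq> b" "b \<noteq> c" "c \<noteq> a" using D by auto
  note poor_ab = poor_line[OF fin card3(1) abc(1,2) ne(1)]
  note poor_bc = poor_line[OF fin card3(2) abc(2,3) ne(2)]
  define U where "U = {v \<in> V - {b}. triple c a v \<noteq> 0}"
  have UV: "u \<in> V" "u \<noteq> a" "u \<noteq> b" "u \<noteq> c" "triple c a u \<noteq> 0" if "u \<in> U" for u
    using that by (auto simp: U_def)
  \<comment> \<open>The common image of the points of the side \<open>ca\<close> other than its
    vertices: there only the middle coordinate of \<open>cremona a b c\<close> can survive.\<close>
  define p :: "real^3" where "p = axis 2 1"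
  have p: "p $ 1 = 0" "p $ 2 = 1" "p $ 3 = 0" by (simp_all add: p_def axis_def)
  have D': "triple b c a \<noteq> 0" "triple c a b \<noteq> 0" using D triple_rotate by metis+
  have pU: "cross3 p (cremona a b c u) \<noteq> 0" if u: "u \<in> U" for u
  proof
    assume "cross3 p (cremona a b c u) = 0"
    then have "triple a b u = 0" "triple b c u = 0"
      using UV(5)[OF u] by (simp_all add: vec_eq_iff[of _ 0] forall_3 cross_components p)
    then show False using parallel_to_vertex[OF D] ind UV[OF u] abc by blast
  qed
  \<comment> \<open>No side contains two points of \<open>U\<close>: \<open>ab\<close> and
    \<open>bc\<close> have at most one point besides their vertices, and \<open>U\<close> avoids
    \<open>ca\<close>.\<close>
  have indU: "cross3 (cremona a b c u) (cremona a b c v) \<noteq> 0" if uv: "u \<in> U" "v \<in> U" "u \<noteq> v" for u v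
  proof (rule cremona_independent[OF D])
    show "cross3 u v \<noteq> 0" using ind UV uv by blast
    show "cross3 x y \<noteq> 0" if "x \<in> {u, v}" "y \<in> {a, b, c}" for x y
      using that ind UV[OF uv(1)] UV[OF uv(2)] abc by auto
    show "triple a b u \<noteq> 0 \<or> triple a b v \<noteq> 0" using poor_ab UV[OF uv(1)] UV[OF uv(2)] uv(3) by auto
    show "triple b c u \<noteq> 0 \<or> triple b c v \<noteq> 0" using poor_bc UV[OF uv(1)] UV[OF uv(2)] uv(3) by auto
    show "triple c a u \<noteq> 0 \<or> triple c a v \<noteq> 0" using UV(5)[OF uv(1)] by simp
  qed
  show "\<exists>q. ordinary_conic V q"
  proof (cases "\<exists>w. w \<noteq> 0 \<and> (\<forall>u\<in>U. w \<bullet> cremona a b c u = 0)")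
    case False
    define T where "T = cremona a b c ` U"
    have "finite T" using fin by (simp add: T_def U_def)
    moreover have "cross3 p t \<noteq> 0" if "t \<in> T" for t using that pU by (auto simp: T_def)
    moreover have "p \<noteq> 0" by (simp add: p_def axis_eq_0_iff)
    moreover have "cross3 s t \<noteq> 0" if "s \<in> T" "t \<in> T" "s \<noteq> t" for s t
      using that indU by (auto simp: T_def)
    moreover have "\<exists>t\<in>T. w \<bullet> t \<noteq> 0" if "w \<noteq> 0" for w using that False by (auto simp: T_def)
    ultimately obtain s t where st: "s \<in> T" "t \<in> T" "s \<noteq> t" "triple s t p \<noteq> 0"
      "\<And>r. r \<in> T \<Longrightarrow> triple s t r = 0 \<Longrightarrow> r = s \<or> r = t"
      using ordinary_line_missing[of T p] by blast
    obtain u v where uv: "u \<in> U" "v \<in> U" "s = cremona a b c u" "t = cremona a b c v" using st by (auto simp: T_def)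
    have "u \<noteq> v" using st(3) uv by auto
    show ?thesis
    proof (rule ordinary_conicI[OF D indU[OF uv(1,2) \<open>u \<noteq> v\<close>]])
      show "{a, b, c, u, v} \<subseteq> V" using UV[OF uv(1)] UV[OF uv(2)] abc by auto
      show "card {a, b, c, u, v} = 5" using UV[OF uv(1)] UV[OF uv(2)] ne \<open>u \<noteq> v\<close> by auto
      fix x assume x: "x \<in> V" "cross3 (cremona a b c u) (cremona a b c v) \<bullet> cremona a b c x = 0"
      then have tr: "triple s t (cremona a b c x) = 0" by (simp add: triple_def uv)
      show "x \<in> {a, b, c, u, v}"
      proof (rule ccontr)
        assume nx: "x \<notin> {a, b, c, u, v}"
        show False
        proof (cases "triple c a x = 0")
          case True
          then have "cremona a b c x = (triple b c x * triple a b x) *\<^sub>R p"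
            by (simp add: vec_eq_iff forall_3 p)
          then have "triple b c x * triple a b x * triple s t p = 0" using tr by simp
          then have "cross3 x c = 0 \<or> cross3 x a = 0"
            using st(4) True parallel_to_vertex[OF D'(1), of x] parallel_to_vertex[OF D'(2), of x] by auto
          then show False using ind x(1) abc nx by auto
        next
          case False
          then have xU: "x \<in> U" using nx x by (simp add: U_def)
          then have "cremona a b c x = cremona a b c u \<or> cremona a b c x = cremona a b c v"
            using st(5)[of "cremona a b c x"] tr uv by (auto simp: T_def)
          then show False using indU[OF xU uv(1)] indU[OF xU uv(2)] nx by auto
        qed
      qed
    qed
  next
    case True
    then obtain w where w: "w \<noteq> 0" "\<And>u. u \<in> U \<Longrightarrow> w \<bullet> cremona a b c u = 0" by blast
    define q where "q v = w \<bullet> cremona a b c v" for v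
    have q: "quadform q" unfolding q_def by (rule quadform_cremona)
    have qabc: "q a = 0" "q b = 0" "q c = 0" by (simp_all add: q_def)
    have "\<exists>x. q x \<noteq> 0" unfolding q_def by (rule cremona_nonzero[OF D w(1)])
    then obtain d where d: "d \<in> V" "q d \<noteq> 0" using no_conic q by blast
    define n where "n = cross3 c a"
    have n: "n \<bullet> v = triple c a v" for v by (simp add: n_def triple_def)
    have n0: "n \<noteq> 0" using ind[OF abc(3,1) ne(3)] by (simp add: n_def)
    have qB: "q v = 0" if "v \<in> V" "n \<bullet> v \<noteq> 0" for v
      using that w(2)[of v] qabc by (cases "v = b") (auto simp: U_def n q_def)
    have nd: "n \<bullet> d = 0" using qB d by blast
    have nabc: "n \<bullet> a = 0" "n \<bullet> c = 0" "n \<bullet> b \<noteq> 0" using D' by (simp_all add: n)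
    \<comment> \<open>As two lines never cover \<open>V\<close>, points \<open>f\<close> and
      \<open>g\<close> off the line \<open>ca\<close> can be chosen such that \<open>b\<close>,
      \<open>f\<close>, \<open>g\<close> are not collinear.\<close>
    obtain f where f: "f \<in> V" "n \<bullet> f \<noteq> 0" "cross3 b a \<bullet> f \<noteq> 0"
      using two[OF n0 ind[OF abc(2,1)]] ne by blast
    then have "b \<noteq> f" by (auto simp: dot_cross_self)
    then obtain g where g: "g \<in> V" "n \<bullet> g \<noteq> 0" "cross3 b f \<bullet> g \<noteq> 0"
      using two[OF n0 ind[OF abc(2) f(1)]] by blast
    then have bfg: "triple b f g \<noteq> 0" by (simp add: triple_def)
    then have fg: "cross3 f g \<noteq> 0" using cross3_nonzeroI triple_rotate by metis
    show ?thesis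
    proof (cases "triple a f g = 0")
      case False
      show ?thesis
        by (rule ordinary_conic_near_line[OF V abc(1,2) d(1) f(1) g(1) nabc(1) nd nabc(3) f(2) g(2)
              q qabc(1) d(2) qB bfg False poor_ab])
    next
      case True
      \<comment> \<open>The line \<open>fg\<close> meets \<open>ca\<close> in one point only; if
        this is \<open>a\<close>, the vertex \<open>c\<close> takes over the role of
        \<open>a\<close>.\<close>
      have cfg: "triple c f g \<noteq> 0"
      proof
        assume "triple c f g = 0"
        then have "cross3 f g \<bullet> c = 0" "cross3 f g \<bullet> a = 0"
          using True triple_rotate by (metis triple_def)+
        then obtain k where k: "cross3 f g = k *\<^sub>R n"
          unfolding n_def using parallel_cross3[OF ind[OF abc(3,1) ne(3)]] by metis
        have "k * (n \<bullet> f) = cross3 f g \<bullet> f" by (simp add: k)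
        then have "k = 0" using f(2) by (simp add: dot_cross_self)
        then show False using k fg by simp
      qed
      have poor_cb: "triple c b u \<noteq> 0 \<or> triple c b v \<noteq> 0" if "u \<in> V - {c, b}" "v \<in> V - {c, b}" "u \<noteq> v" for u v
        using poor_bc[of u v] that by (auto simp: triple_swap[of c b])
      show ?thesis
        by (rule ordinary_conic_near_line[OF V abc(3,2) d(1) f(1) g(1) nabc(2) nd nabc(3) f(2) g(2)
              q qabc(3) d(2) qB bfg cfg poor_cb])
    qed
  qed
qed

section \<open>Conics as polynomials\<close>

definition exponents :: "(3 \<Rightarrow>\<^sub>0 nat) \<Rightarrow> nat \<times> nat \<times> nat" where
  "exponents m = (Poly_Mapping.lookup m 1, Poly_Mapping.lookup m 2, Poly_Mapping.lookup m 3)"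

definition monomial :: "nat \<times> nat \<times> nat \<Rightarrow> 3 \<Rightarrow>\<^sub>0 nat" where
  "monomial = (\<lambda>(a, b, c). Poly_Mapping.single 1 a + Poly_Mapping.single 2 b + Poly_Mapping.single 3 c)"

definition degree2 :: "(nat \<times> nat \<times> nat) set" where
  "degree2 = {(2, 0, 0), (0, 2, 0), (0, 0, 2), (1, 1, 0), (1, 0, 1), (0, 1, 1)}"

lemma exponents_monomial [simp]: "exponents (monomial t) = t"
  by (cases t) (simp add: exponents_def monomial_def lookup_add lookup_single when_def)

lemma monomial_exponents [simp]: "monomial (exponents m) = m"
proof (rule poly_mapping_eqI)
  fix i :: 3
  have "\<forall>i. Poly_Mapping.lookup (monomial (exponents m)) i = Poly_Mapping.lookup m i"
    by (simp add: forall_3 exponents_def monomial_def lookup_add lookup_single when_def)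
  then show "Poly_Mapping.lookup (monomial (exponents m)) i = Poly_Mapping.lookup m i" ..
qed

lemma exponents_degree2: "exponents m \<in> degree2 \<longleftrightarrow> (\<Sum>i\<in>UNIV. Poly_Mapping.lookup m i) = 2"
proof -
  have "(a, b, c) \<in> degree2 \<longleftrightarrow> a + b + c = 2" for a b c
  proof
    assume sum: "a + b + c = 2"
    then have "a = 0 \<or> a = 1 \<or> a = 2" "b = 0 \<or> b = 1 \<or> b = 2" by linarith+
    then show "(a, b, c) \<in> degree2" using sum by (elim disjE) (simp_all add: degree2_def)
  qed (auto simp: degree2_def)
  then show ?thesis by (simp add: sum_3 exponents_def)
qed

lemma poly3_eval_degree2:
  assumes "homogeneous3 2 p"
  shows "poly3_eval p v =
    (\<Sum>(a, b, c)\<in>degree2. Poly_Mapping.lookup p (monomial (a, b, c)) * (v$1 ^ a * v$2 ^ b * v$3 ^ c))"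
proof -
  have prod3: "(\<Prod>i\<in>UNIV. f i) = f 1 * f 2 * f 3" for f :: "3 \<Rightarrow> real"
    unfolding UNIV_3 by (simp add: mult.assoc)
  have "poly3_eval p v = (\<Sum>m\<in>monomial ` degree2. Poly_Mapping.lookup p m * (\<Prod>i\<in>UNIV. v $ i ^ Poly_Mapping.lookup m i))"
    unfolding poly3_eval_def
  proof (rule sum.mono_neutral_left)
    show "finite (monomial ` degree2)" by (simp add: degree2_def)
    show "Poly_Mapping.keys p \<subseteq> monomial ` degree2"
      using assms exponents_degree2 monomial_exponents unfolding homogeneous3_def by (metis image_eqI subsetI)
  qed (simp add: in_keys_iff)
  also have "\<dots> = (\<Sum>t\<in>degree2. Poly_Mapping.lookup p (monomial t) * (\<Prod>i\<in>UNIV. v $ i ^ Poly_Mapping.lookup (monomial t) i))"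
    by (rule sum.reindex_cong[of monomial]) (auto intro: inj_on_inverseI[of _ exponents])
  also have "\<dots> = (\<Sum>(a, b, c)\<in>degree2. Poly_Mapping.lookup p (monomial (a, b, c)) * (v$1 ^ a * v$2 ^ b * v$3 ^ c))"
    by (rule sum.cong) (auto simp: prod3 monomial_def lookup_add lookup_single when_def)
  finally show ?thesis .
qed

lemma sum_degree2:
  "(\<Sum>(a, b, c)\<in>degree2. f a b c * (v$1 ^ a * v$2 ^ b * v$3 ^ c)) =
    f 2 0 0 * (v$1)\<^sup>2 + f 0 2 0 * (v$2)\<^sup>2 + f 0 0 2 * (v$3)\<^sup>2
    + f 1 1 0 * (v$1 * v$2) + f 1 0 1 * (v$1 * v$3) + f 0 1 1 * (v$2 * v$3)"
  for f :: "nat \<Rightarrow> nat \<Rightarrow> nat \<Rightarrow> real" and v :: "real^3"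
  by (simp add: degree2_def)

lemma quadform_poly3_eval:
  assumes "homogeneous3 2 p"
  shows "quadform (poly3_eval p)"
proof -
  define f where "f a b c = Poly_Mapping.lookup p (monomial (a, b, c))" for a b c
  define M :: "real^3^3" where "M = vector [vector [f 2 0 0, f 1 1 0, f 1 0 1],
    vector [0, f 0 2 0, f 0 1 1], vector [0, 0, f 0 0 2]]"
  have "poly3_eval p v = v \<bullet> (M *v v)" for v
    unfolding poly3_eval_degree2[OF assms] f_def[symmetric] sum_degree2
    by (simp add: M_def inner_real3 matrix_vector_mult_def sum_3 power2_eq_square algebra_simps)
  then show ?thesis unfolding quadform_def by blast
qed

lemma quadform_obtain_poly3:
  assumes "quadform q"
  obtains p where "homogeneous3 2 p" "poly3_eval p = q"
proof -
  obtain M :: "real^3^3" where M: "\<And>v. q v = v \<bullet> (M *v v)" using assms by (auto simp: quadform_def)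
  \<comment> \<open>A mixed monomial collects the two matrix entries placed symmetrically to the
    diagonal.\<close>
  define g where "g t = (if t = (2, 0, 0) then M$1$1 else if t = (0, 2, 0) then M$2$2
    else if t = (0, 0, 2) then M$3$3 else if t = (1, 1, 0) then M$1$2 + M$2$1
    else if t = (1, 0, 1) then M$1$3 + M$3$1 else if t = (0, 1, 1) then M$2$3 + M$3$2 else 0)"
    for t :: "nat \<times> nat \<times> nat"
  define p :: poly3 where "p = Abs_poly_mapping (\<lambda>m. g (exponents m))"
  have "{m. g (exponents m) \<noteq> 0} \<subseteq> monomial ` degree2"
  proof
    fix m assume "m \<in> {m. g (exponents m) \<noteq> 0}"
    then have "exponents m \<in> degree2" by (auto simp: g_def degree2_def split: if_splits)
    then show "m \<in> monomial ` degree2" using monomial_exponents by (metis image_eqI)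
  qed
  then have "finite {m. g (exponents m) \<noteq> 0}"
    by (rule finite_subset) (simp add: degree2_def)
  then have lookup_p: "Poly_Mapping.lookup p m = g (exponents m)" for m
    by (simp add: p_def lookup_Abs_poly_mapping)
  have hom: "homogeneous3 2 p"
    unfolding homogeneous3_def exponents_degree2[symmetric]
    by (auto simp: in_keys_iff lookup_p g_def degree2_def split: if_splits)
  have "poly3_eval p v = q v" for v
    unfolding poly3_eval_degree2[OF hom] sum_degree2[where f = "\<lambda>a b c. Poly_Mapping.lookup p (monomial (a, b, c))"] M
    by (simp add: lookup_p g_def inner_real3 matrix_vector_mult_def sum_3 power2_eq_square algebra_simps)
  then show thesis using that hom by blast
qed

text \<open>The values at the unit vectors and at their pairwise sums determine the six
  coefficients. This carries uniqueness from forms to conics, which are polynomials and not zero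
  sets.\<close>

lemma poly3_eval_eq_imp_eq:
  assumes p: "homogeneous3 2 p" and r: "homogeneous3 2 r"
    and eq: "\<And>v. poly3_eval r v = poly3_eval p v"
  shows "r = p"
proof -
  define h where "h a b c = Poly_Mapping.lookup r (monomial (a, b, c)) - Poly_Mapping.lookup p (monomial (a, b, c))"
    for a b c
  have zero: "h 2 0 0 * (v$1)\<^sup>2 + h 0 2 0 * (v$2)\<^sup>2 + h 0 0 2 * (v$3)\<^sup>2
    + h 1 1 0 * (v$1 * v$2) + h 1 0 1 * (v$1 * v$3) + h 0 1 1 * (v$2 * v$3) = 0" for v :: "real^3"
    using eq[of v]
    unfolding poly3_eval_degree2[OF p] poly3_eval_degree2[OF r]
      sum_degree2[where f = "\<lambda>a b c. Poly_Mapping.lookup p (monomial (a, b, c))"]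
      sum_degree2[where f = "\<lambda>a b c. Poly_Mapping.lookup r (monomial (a, b, c))"]
    by (simp add: h_def algebra_simps)
  have "h 2 0 0 = 0" "h 0 2 0 = 0" "h 0 0 2 = 0"
    using zero[of "vector [1, 0, 0]"] zero[of "vector [0, 1, 0]"] zero[of "vector [0, 0, 1]"] by simp_all
  moreover from this have "h 1 1 0 = 0" "h 1 0 1 = 0" "h 0 1 1 = 0"
    using zero[of "vector [1, 1, 0]"] zero[of "vector [1, 0, 1]"] zero[of "vector [0, 1, 1]"] by simp_all
  ultimately have deg2: "Poly_Mapping.lookup r (monomial t) = Poly_Mapping.lookup p (monomial t)" if "t \<in> degree2" for t
    using that by (auto simp: degree2_def h_def)
  show ?thesis
  proof (rule poly_mapping_eqI)
    fix m
    show "Poly_Mapping.lookup r m = Poly_Mapping.lookup p m"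
    proof (cases "exponents m \<in> degree2")
      case True
      then show ?thesis using deg2[of "exponents m"] by simp
    next
      case False
      then have "m \<notin> Poly_Mapping.keys r" "m \<notin> Poly_Mapping.keys p"
        using p r exponents_degree2 unfolding homogeneous3_def by blast+
      then show ?thesis by (simp add: in_keys_iff)
    qed
  qed
qed

lemma poly3_eval_zero: "poly3_eval 0 v = 0"
  by (simp add: poly3_eval_def)

lemma poly3_eval_nonzero:
  assumes "homogeneous3 2 p" "p \<noteq> 0"
  shows "\<exists>v. poly3_eval p v \<noteq> 0"
proof (rule ccontr)
  assume "\<not> ?thesis"
  moreover have "homogeneous3 2 0" by (simp add: homogeneous3_def)
  ultimately show False using poly3_eval_eq_imp_eq[of 0 p] assms by (simp add: poly3_eval_zero)
qed

section \<open>Points and conics through their representatives\<close>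

lemma proj_rel_rep: "proj_rel (rep_rp2 x) (rep_rp2 x)"
  using Quotient_rep_reflp[OF Quotient_rp2] .

lemma conic_rel_rep: "conic_rel (rep_conic C) (rep_conic C)"
  using Quotient_rep_reflp[OF Quotient_conic] .

lemma rep_rp2_nonzero: "rep_rp2 x \<noteq> 0"
  using proj_rel_rep[of x] by (simp add: proj_rel_def)

lemma cross3_rep_rp2:
  assumes "x \<noteq> y"
  shows "cross3 (rep_rp2 x) (rep_rp2 y) \<noteq> 0"
proof
  define u v where "u = rep_rp2 x" "v = rep_rp2 y"
  assume "cross3 (rep_rp2 x) (rep_rp2 y) = 0"
  then have "cross3 u v = 0" by (simp add: u_v_def)
  then have eq: "(u \<bullet> u) *\<^sub>R v = (u \<bullet> v) *\<^sub>R u" using Lagrange[of u u v] by simp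
  have nz: "u \<noteq> 0" "v \<noteq> 0" by (simp_all add: u_v_def rep_rp2_nonzero)
  then have "u \<bullet> v \<noteq> 0" using eq by auto
  moreover have "v = inverse (u \<bullet> u) *\<^sub>R ((u \<bullet> v) *\<^sub>R u)"
    using eq nz(1) by (metis inner_eq_zero_iff real_vector.scale_scale left_inverse scaleR_one)
  then have "v = (inverse (u \<bullet> u) * (u \<bullet> v)) *\<^sub>R u" by simp
  ultimately have "proj_rel u v"
    using nz unfolding proj_rel_def by (metis inner_eq_zero_iff mult_eq_0_iff nonzero_imp_inverse_nonzero)
  then have "abs_rp2 u = abs_rp2 v" using Quotient_rel[OF Quotient_rp2] by metis
  then show False using assms Quotient_abs_rep[OF Quotient_rp2] by (simp add: u_v_def)
qed

lemma lies_on_rep: "lies_on x C \<longleftrightarrow> poly3_eval (rep_conic C) (rep_rp2 x) = 0"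
  using lies_on.abs_eq[OF proj_rel_rep conic_rel_rep, of x C]
  by (simp add: Quotient_abs_rep[OF Quotient_rp2] Quotient_abs_rep[OF Quotient_conic])

text \<open>The second property turns proportionality of forms into equality of conics;
  \<open>k\<close> is nonzero there because a representative of a conic has a nonzero value.\<close>

lemma obtain_conic:
  assumes q: "quadform q" "\<exists>v. q v \<noteq> 0"
  obtains C where "\<And>x. lies_on x C \<longleftrightarrow> q (rep_rp2 x) = 0"
    "\<And>D k. \<forall>v. poly3_eval (rep_conic D) v = k * q v \<Longrightarrow> D = C"
proof -
  obtain p where p: "homogeneous3 2 p" "poly3_eval p = q" using quadform_obtain_poly3[OF q(1)] by blast
  have p0: "p \<noteq> 0" using p(2) q(2) poly3_eval_zero by metis
  have rel: "conic_rel p p" using p p0 by (auto simp: conic_rel_def intro!: exI[of _ 1])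
  have lies: "lies_on x (abs_conic p) \<longleftrightarrow> q (rep_rp2 x) = 0" for x
    using lies_on.abs_eq[OF proj_rel_rep rel, of x] p(2) by (simp add: Quotient_abs_rep[OF Quotient_rp2])
  have unique: "D = abs_conic p" if D: "\<forall>v. poly3_eval (rep_conic D) v = k * q v" for D k
  proof -
    have r: "homogeneous3 2 (rep_conic D)" "rep_conic D \<noteq> 0"
      using conic_rel_rep[of D] by (auto simp: conic_rel_def)
    have k: "k \<noteq> 0" using poly3_eval_nonzero[OF r] D by auto
    have hom: "homogeneous3 2 (poly3_scale k p)" using p(1) k by (simp add: homogeneous3_def keys_poly3_scale)
    have "rep_conic D = poly3_scale k p"
      using poly3_eval_eq_imp_eq[OF hom r(1)] D p(2) k by (simp add: poly3_eval_scale)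
    then have "conic_rel p (rep_conic D)" using p p0 r k by (auto simp: conic_rel_def)
    then have "abs_conic p = abs_conic (rep_conic D)" using Quotient_rel[OF Quotient_conic] by metis
    then show ?thesis by (simp add: Quotient_abs_rep[OF Quotient_conic])
  qed
  show thesis
  proof (rule that[of "abs_conic p"])
    show "lies_on x (abs_conic p) \<longleftrightarrow> q (rep_rp2 x) = 0" for x by (rule lies)
    show "D = abs_conic p" if "\<forall>v. poly3_eval (rep_conic D) v = k * q v" for D k using that by (rule unique)
  qed
qed

theorem theorem1p4:
  fixes P :: "rp2 set"
  assumes "finite P"
  shows "(\<exists>C. \<forall>x\<in>P. lies_on x C) \<or>
         (\<exists>C Q. Q = {x \<in> P. lies_on x C} \<and> card Q = 5 \<and>
            (\<forall>D. (\<forall>x\<in>Q. lies_on x D) \<longrightarrow> D = C))"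
proof (cases "\<exists>q. quadform q \<and> (\<exists>x. q x \<noteq> 0) \<and> (\<forall>v\<in>rep_rp2 ` P. q v = 0)")
  case True
  then obtain q where q: "quadform q" "\<exists>x. q x \<noteq> 0" "\<forall>v\<in>rep_rp2 ` P. q v = 0" by blast
  obtain C where "\<And>x. lies_on x C \<longleftrightarrow> q (rep_rp2 x) = 0" using obtain_conic[OF q(1,2)] by metis
  then show ?thesis using q(3) by blast
next
  case False
  have inj: "inj rep_rp2" using cross3_rep_rp2 cross_refl by (metis injI)
  have "0 \<notin> rep_rp2 ` P" using rep_rp2_nonzero by (metis imageE)
  moreover have "cross3 u v \<noteq> 0" if "u \<in> rep_rp2 ` P" "v \<in> rep_rp2 ` P" "u \<noteq> v" for u v
    using that cross3_rep_rp2 by (metis imageE)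
  ultimately have "independent_points (rep_rp2 ` P)"
    using assms by (simp add: independent_points_def)
  then obtain q where q: "ordinary_conic (rep_rp2 ` P) q" using ordinary_conic_exists False by blast
  then have q': "quadform q" "\<exists>x. q x \<noteq> 0" by (simp_all add: ordinary_conic_def)
  obtain C where C: "\<And>x. lies_on x C \<longleftrightarrow> q (rep_rp2 x) = 0"
    "\<And>D k. \<forall>v. poly3_eval (rep_conic D) v = k * q v \<Longrightarrow> D = C" using obtain_conic[OF q'] by metis
  define Q where "Q = {x \<in> P. lies_on x C}"
  have "{v \<in> rep_rp2 ` P. q v = 0} = rep_rp2 ` Q" by (auto simp: Q_def C(1))
  then have "card Q = 5"
    using q card_image[OF inj_on_subset[OF inj], of Q] by (simp add: ordinary_conic_def)
  moreover have "D = C" if D: "\<forall>x\<in>Q. lies_on x D" for D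
  proof -
    \<comment> \<open>The representative of \<open>D\<close> is a form vanishing at the five points,
      hence a multiple of \<open>q\<close>.\<close>
    have "quadform (poly3_eval (rep_conic D))"
      using conic_rel_rep[of D] by (intro quadform_poly3_eval) (simp add: conic_rel_def)
    moreover have "poly3_eval (rep_conic D) (rep_rp2 x) = 0" if "x \<in> P" "q (rep_rp2 x) = 0" for x
      using D that C(1) by (simp add: Q_def flip: lies_on_rep)
    ultimately obtain k where "\<forall>v. poly3_eval (rep_conic D) v = k * q v"
      using q unfolding ordinary_conic_def by blast
    then show ?thesis by (rule C(2))
  qed
  ultimately show ?thesis using Q_def by blast
qed

end
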